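(* Let $r,s\in(0,+\infty)$ with $s>r$, and let $X$ be a random variable taking values in $\mathbb{R}^d$ with distribution $P=f\cdot\lambda_d$ such that $\mathbb{E}|X|^{r+\eta}<\infty$ for some $\eta>0$. Let $(\alpha_n)_{n\ge1}$ be an $L^r(P)$-optimal sequence of quantizers, let $\mu\in\mathbb{R}^d$ and $b\in(0,1/2)$. There is a positive real constant $C(b)$, not depending on $\theta$ and $n$, such that for every $\theta>0$ for which $P_{\theta,\mu}\ll P$ (absolute continuity) and the maximal function $\psi_b$ satisfies $$\psi_b^{s/(d+r)}\in L^1(P_{\theta,\mu}),$$ one has $$\limsup_{n}\,n^{s/d}\,\|X-\widehat X^{\alpha_n^{\theta,\mu}}\|_s^s\;\le\;\theta^{s+d}\,C(b)\int f_{\theta,\mu}\,f^{-\frac{s}{d+r}}\,d\lambda_d<+\infty .$$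
   Context: $\lambda_d$ is Lebesgue measure on $\mathbb{R}^d$, $|\cdot|$ is a norm on $\mathbb{R}^d$, $B(x,\rho)$ is the ball of center $x$ and radius $\rho$, and $d(x,\alpha)=\min_{a\in\alpha}|x-a|$ for a finite nonempty $\alpha\subset\mathbb{R}^d$. $\widehat X^{\alpha}$ denotes a Voronoi quantization (nearest-neighbour projection) of $X$ on $\alpha$, so $\|X-\widehat X^{\alpha}\|_s^s=\mathbb{E}\,d(X,\alpha)^s$. A sequence of quantizers $(\alpha_n)_{n\ge1}$ is a sequence of finite nonempty sets $\alpha_n\subset\mathbb{R}^d$ with $\mathrm{card}(\alpha_n)\le n$; it is $L^r(P)$-optimal if for all $n\ge1$, $\int d(x,\alpha_n)^r dP(x)=\inf_{\mathrm{card}(\alpha)\le n}\int d(x,\alpha)^r dP(x)$. The maximal function associated with $(\alpha_n)$ is $\psi_b:\mathbb{R}^d\to\mathbb{R}_+\cup\{+\infty\}$, $$\psi_b(x)=\sup_{n\ge1}\frac{\lambda_d\bigl(B(x,b\,d(x,\alpha_n))\bigr)}{P\bigl(B(x,b\,d(x,\alpha_n))\bigr)}.$$ For $\theta>0$, $\mu\in\mathbb{R}^d$: $\alpha_n^{\theta,\mu}=\{\mu+\theta(a-\mu):a\in\alpha_n\}$; $f_{\theta,\mu}(x)=f(\mu+\theta(x-\mu))$; and $P_{\theta,\mu}$ is the distribution of $\frac{X-\mu}{\theta}+\mu$ when $X\sim P$. When $P_{\theta,\mu}\ll P$, $f_{\theta,\mu}=0$ $\lambda_d$-a.e. on $\{f=0\}$,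 and the integrand $f_{\theta,\mu}f^{-s/(d+r)}$ is read as $0$ there. *)

theory Defs
  imports "HOL-Probability.Probability"
begin

text \<open>The space \<open>\<real>\<^sup>d\<close> is the type \<open>real ^ 'd\<close>, with \<open>d = CARD('d)\<close>. Since the norm of the statement
  is arbitrary, it is a function \<open>N\<close> and not the (Euclidean) library norm of that type.\<close>

definition is_norm :: "('v::real_vector \<Rightarrow> real) \<Rightarrow> bool" where
  "is_norm N \<longleftrightarrow> (\<forall>x. N x \<ge> 0) \<and> (\<forall>x. N x = 0 \<longleftrightarrow> x = 0) \<and>
     (\<forall>c x. N (c *\<^sub>R x) = \<bar>c\<bar> * N x) \<and> (\<forall>x y. N (x + y) \<le> N x + N y)"

definition nball :: "('v::real_vector \<Rightarrow> real) \<Rightarrow> 'v \<Rightarrow> real \<Rightarrow> 'v set" where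
  "nball N x \<rho> = {y. N (y - x) \<le> \<rho>}"

definition ndist :: "('v::real_vector \<Rightarrow> real) \<Rightarrow> 'v \<Rightarrow> 'v set \<Rightarrow> real" where
  "ndist N x A = Min ((\<lambda>a. N (x - a)) ` A)"

definition quantizers :: "nat \<Rightarrow> 'v set set" where
  "quantizers n = {A. finite A \<and> A \<noteq> {} \<and> card A \<le> n}"

definition distortion ::
  "(real ^ 'd \<Rightarrow> real) \<Rightarrow> real \<Rightarrow> (real ^ 'd) measure \<Rightarrow> (real ^ 'd) set \<Rightarrow> ennreal" where
  "distortion N r P A = (\<integral>\<^sup>+ x. ennreal (ndist N x A powr r) \<partial>P)"

definition optimal_quantizers ::
  "(real ^ 'd \<Rightarrow> real) \<Rightarrow> real \<Rightarrow> (real ^ 'd) measure \<Rightarrow> (nat \<Rightarrow> (real ^ 'd) set) \<Rightarrow> bool" where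
  "optimal_quantizers N r P \<alpha> \<longleftrightarrow>
     (\<forall>n\<ge>1. \<alpha> n \<in> quantizers n \<and>
        distortion N r P (\<alpha> n) = (INF A\<in>quantizers n. distortion N r P A))"

definition nearest_neighbour_projection ::
  "(real ^ 'd \<Rightarrow> real) \<Rightarrow> (real ^ 'd) set \<Rightarrow> (real ^ 'd \<Rightarrow> real ^ 'd) \<Rightarrow> bool" where
  "nearest_neighbour_projection N A \<pi> \<longleftrightarrow>
     \<pi> \<in> borel_measurable borel \<and> (\<forall>x. \<pi> x \<in> A \<and> N (x - \<pi> x) = ndist N x A)"

definition voronoi_quantization ::
  "(real ^ 'd \<Rightarrow> real) \<Rightarrow> 'w measure \<Rightarrow> ('w \<Rightarrow> real ^ 'd) \<Rightarrow> (real ^ 'd) set \<Rightarrow> ('w \<Rightarrow> real ^ 'd) \<Rightarrow> bool"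
  where
  "voronoi_quantization N M X A Y \<longleftrightarrow>
     (\<exists>\<pi>. nearest_neighbour_projection N A \<pi> \<and> (\<forall>\<omega>\<in>space M. Y \<omega> = \<pi> (X \<omega>)))"

text \<open>The \<open>p\<close>-th power of the \<open>L\<^sup>p\<close> norm of the vector-valued \<open>Y\<close>.\<close>

definition Lp_norm_pow ::
  "(real ^ 'd \<Rightarrow> real) \<Rightarrow> 'w measure \<Rightarrow> real \<Rightarrow> ('w \<Rightarrow> real ^ 'd) \<Rightarrow> ennreal" where
  "Lp_norm_pow N M p Y = (\<integral>\<^sup>+ \<omega>. ennreal (N (Y \<omega>) powr p) \<partial>M)"

text \<open>Division in \<^typ>\<open>ennreal\<close>: a positive number divided by \<open>0\<close> is \<open>\<infinity>\<close>, and \<open>0 / 0 = 0\<close>. The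
  latter only matters if \<open>x\<close> belongs to some \<open>\<alpha> n\<close>, hence on a countable set.\<close>

definition maximal_fun ::
  "(real ^ 'd \<Rightarrow> real) \<Rightarrow> (real ^ 'd) measure \<Rightarrow> (nat \<Rightarrow> (real ^ 'd) set) \<Rightarrow> real \<Rightarrow> real ^ 'd \<Rightarrow> ennreal"
  where
  "maximal_fun N P \<alpha> b x =
     (SUP n\<in>{1..}. emeasure lborel (nball N x (b * ndist N x (\<alpha> n))) /
                   emeasure P (nball N x (b * ndist N x (\<alpha> n))))"

text \<open>Real powers on \<open>[0, \<infinity>]\<close>, meant for exponents \<open>p > 0\<close>.\<close>

definition ennpowr :: "ennreal \<Rightarrow> real \<Rightarrow> ennreal" where
  "ennpowr x p = (if x = \<infinity> then \<infinity> else ennreal (enn2real x powr p))"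

definition in_L1 :: "'v measure \<Rightarrow> ('v \<Rightarrow> ennreal) \<Rightarrow> bool" where
  "in_L1 Q g \<longleftrightarrow> g \<in> borel_measurable Q \<and> (\<integral>\<^sup>+ x. g x \<partial>Q) < \<infinity>"

definition dilated_set :: "real \<Rightarrow> 'v::real_vector \<Rightarrow> 'v set \<Rightarrow> 'v set" where
  "dilated_set \<theta> \<mu> A = (\<lambda>a. \<mu> + \<theta> *\<^sub>R (a - \<mu>)) ` A"

definition dilated_fun :: "real \<Rightarrow> 'v::real_vector \<Rightarrow> ('v \<Rightarrow> real) \<Rightarrow> 'v \<Rightarrow> real" where
  "dilated_fun \<theta> \<mu> f x = f (\<mu> + \<theta> *\<^sub>R (x - \<mu>))"

definition dilated_measure :: "real \<Rightarrow> real ^ 'd \<Rightarrow> (real ^ 'd) measure \<Rightarrow> (real ^ 'd) measure" where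
  "dilated_measure \<theta> \<mu> P = distr P borel (\<lambda>x. (x - \<mu>) /\<^sub>R \<theta> + \<mu>)"

text \<open>Since \<open>0 powr a = 0\<close> for every \<open>a\<close>, the integrand vanishes on the set where \<open>f\<close> does.\<close>

definition dilation_integral :: "(real ^ 'd \<Rightarrow> real) \<Rightarrow> real \<Rightarrow> real \<Rightarrow> real \<Rightarrow> real ^ 'd \<Rightarrow> ennreal" where
  "dilation_integral f r s \<theta> \<mu> =
     (\<integral>\<^sup>+ x. ennreal (dilated_fun \<theta> \<mu> f x * f x powr (- (s / (real CARD('d) + r)))) \<partial>lborel)"

text \<open>Voronoi quantizations exist, so quantifying over all of them is not vacuous.\<close>

lemma is_norm_borel_measurable:
  fixes N :: "real ^ 'd \<Rightarrow> real"
  assumes "is_norm N"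
  shows "N \<in> borel_measurable borel"
proof -
  have tri: "N (x + y) \<le> N x + N y" and hom: "N (c *\<^sub>R x) = \<bar>c\<bar> * N x" for x y c
    using assms by (auto simp: is_norm_def)
  have "convex_on UNIV N"
  proof (rule convex_onI)
    fix t :: real and x y :: "real ^ 'd"
    assume "0 < t" "t < 1"
    then show "N ((1 - t) *\<^sub>R x + t *\<^sub>R y) \<le> (1 - t) * N x + t * N y"
      using tri[of "(1 - t) *\<^sub>R x" "t *\<^sub>R y"] by (simp add: hom)
  qed simp
  then have "continuous_on UNIV N"
    by (rule convex_on_continuous[OF open_UNIV])
  then show ?thesis
    by (rule borel_measurable_continuous_onI)
qed

lemma nearest_neighbour_projection_exists:
  fixes N :: "real ^ 'd \<Rightarrow> real"
  assumes N: "is_norm N" and "finite A" "A \<noteq> {}"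
  shows "\<exists>\<pi>. nearest_neighbour_projection N A \<pi>"
  using assms(2,3)
proof (induction A rule: finite_ne_induct)
  case (singleton a)
  show ?case
    by (rule exI[of _ "\<lambda>_. a"]) (simp add: nearest_neighbour_projection_def ndist_def)
next
  case (insert a F)
  then obtain \<pi> where [measurable]: "\<pi> \<in> borel_measurable borel"
    and \<pi>: "\<And>x. \<pi> x \<in> F" "\<And>x. N (x - \<pi> x) = ndist N x F"
    by (auto simp: nearest_neighbour_projection_def)
  note [measurable] = is_norm_borel_measurable[OF N]
  let ?q = "\<lambda>x. if N (x - a) \<le> N (x - \<pi> x) then a else \<pi> x"
  have "?q \<in> borel_measurable borel" by measurable
  moreover have "ndist N x (insert a F) = min (N (x - a)) (ndist N x F)" for x
    using insert.hyps by (simp add: ndist_def)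
  ultimately have "nearest_neighbour_projection N (insert a F) ?q"
    unfolding nearest_neighbour_projection_def using \<pi>(1) by (simp add: \<pi>(2) min_def)
  then show ?case by blast
qed

end

theory Submission
  imports Defs
begin

text \<open>
  Write \<open>d = CARD('d)\<close>, \<open>D n x = ndist N x (\<alpha> n)\<close>, \<open>B n x = nball N x (b * D n x)\<close>, \<open>\<lambda>\<close> for Lebesgue
  measure and \<open>p = s / (d + r)\<close>.

  The theorem rests on the pointwise bound
  \<open>D n x powr r * P (B n x) \<le> C * n powr (- (1 + r / d))\<close>, valid for all \<open>x\<close> and all large \<open>n\<close>
  (\<open>optimal_quantizers_pointwise_rate\<close>). As \<open>\<lambda> (B n x)\<close> is proportional to \<open>D n x ^ d\<close>, it can be
  rewritten as \<open>n powr (s / d) * D n x powr s \<le> E * (\<lambda> (B n x) / P (B n x)) powr p\<close>, and the right-hand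
  side is at most \<open>E\<close> times the power \<open>p\<close> of the maximal function. Where \<open>f > 0\<close> and the maximal
  function is finite, \<open>D n x\<close> tends to \<open>0\<close>, and by Lebesgue differentiation for the balls of \<open>N\<close>
  (\<open>lebesgue_differentiation_nball\<close>) the quotient \<open>\<lambda> (B n x) / P (B n x)\<close> tends to \<open>1 / f x\<close>. After a
  change of variables, \<open>n powr (s / d)\<close> times the \<open>s\<close>-th power of the quantization error is \<open>\<theta> powr s\<close>
  times the integral of \<open>n powr (s / d) * D n x powr s\<close> under the dilated distribution, which has
  density \<open>\<theta> ^ d * dilated_fun \<theta> \<mu> f\<close> and does not charge \<open>{f = 0}\<close>; the maximal function dominates, and
  the reverse Fatou lemma gives the claim. The same differentiation shows that \<open>f powr (- p)\<close> is at
  most a constant times the power of the maximal function, so the bound is finite.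

  For the pointwise bound, compare \<open>\<alpha> n\<close> with the set in which a point \<open>a\<close> is replaced by \<open>x\<close>. By
  optimality, the gain due to \<open>x\<close>, which is at least a constant times \<open>D n x powr r * P (B n x)\<close> since
  \<open>b < 1 / 2\<close>, is at most the cost of removing \<open>a\<close> (\<open>exchange_inequality\<close>). It remains to find a point
  whose removal costs at most a constant times \<open>n powr (- (1 + r / d))\<close> (\<open>exists_cheap_point\<close>). The
  moment condition gives a distortion of order \<open>n powr (- r / d)\<close> (\<open>optimal_distortion_rate\<close>).
  This rate in turn forces a number of points
  proportional to \<open>n\<close> to lie in a fixed bounded region (\<open>card_points_in_bounded_region\<close>). By a packing
  argument, at least half of these have a neighbour within a distance of order \<open>n powr (- 1 / d)\<close>, and
  the cheapest of them costs no more than their average.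
\<close>

section \<open>Norms, balls and distances to finite sets\<close>

lemma is_norm_nonneg: "is_norm N \<Longrightarrow> 0 \<le> N x"
  and is_norm_eq_0: "is_norm N \<Longrightarrow> N x = 0 \<longleftrightarrow> x = 0"
  and is_norm_scaleR: "is_norm N \<Longrightarrow> N (c *\<^sub>R x) = \<bar>c\<bar> * N x"
  and is_norm_triangle: "is_norm N \<Longrightarrow> N (x + y) \<le> N x + N y"
  by (auto simp: is_norm_def)

lemma is_norm_minus_commute: "is_norm N \<Longrightarrow> N (x - y) = N (y - x)"
  using is_norm_scaleR[of N "-1" "x - y"] by simp

lemma is_norm_triangle_diff: "is_norm N \<Longrightarrow> N (x - z) \<le> N (x - y) + N (y - z)"
  using is_norm_triangle[of N "x - y" "y - z"] by simp

lemma is_norm_continuous: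
  fixes N :: "'a::euclidean_space \<Rightarrow> real"
  assumes "is_norm N"
  shows "continuous_on UNIV N"
proof -
  have "convex_on UNIV N"
  proof (rule convex_onI)
    fix t :: real and x y :: 'a
    assume "0 < t" "t < 1"
    then show "N ((1 - t) *\<^sub>R x + t *\<^sub>R y) \<le> (1 - t) * N x + t * N y"
      using is_norm_triangle[OF assms, of "(1 - t) *\<^sub>R x" "t *\<^sub>R y"]
      by (simp add: is_norm_scaleR[OF assms])
  qed simp
  then show ?thesis
    by (rule convex_on_continuous[OF open_UNIV])
qed

text \<open>The bounds are the extreme values of \<open>N\<close> on the compact Euclidean unit sphere, extended by
  homogeneity.\<close>

lemma is_norm_equivalent:
  fixes N :: "'a::euclidean_space \<Rightarrow> real"
  assumes N: "is_norm N"
  obtains m K where "0 < m" "0 < K" "\<And>x. m * norm x \<le> N x" "\<And>x. N x \<le> K * norm x"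
proof -
  have cont: "continuous_on (sphere (0::'a) 1) N"
    using is_norm_continuous[OF N] by (rule continuous_on_subset) simp
  have ne: "sphere (0::'a) 1 \<noteq> {}"
    by (simp add: sphere_eq_empty)
  obtain u where u: "u \<in> sphere 0 1" "\<And>y. y \<in> sphere 0 1 \<Longrightarrow> N u \<le> N y"
    using continuous_attains_inf[OF compact_sphere ne cont] by blast
  obtain w where w: "w \<in> sphere 0 1" "\<And>y. y \<in> sphere 0 1 \<Longrightarrow> N y \<le> N w"
    using continuous_attains_sup[OF compact_sphere ne cont] by blast
  have pos: "0 < N u"
    using u(1) is_norm_nonneg[OF N, of u] is_norm_eq_0[OF N, of u] by (cases "u = 0") auto
  have "N u * norm x \<le> N x \<and> N x \<le> N w * norm x" for x
  proof (cases "x = 0")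
    case True
    then show ?thesis using is_norm_eq_0[OF N, of 0] by simp
  next
    case False
    let ?y = "x /\<^sub>R norm x"
    have y: "?y \<in> sphere 0 1" using False by simp
    have "N x = norm x * N ?y"
      using False by (simp add: is_norm_scaleR[OF N])
    then show ?thesis
      using u(2)[OF y] w(2)[OF y] False by (simp add: mult.commute mult_left_mono)
  qed
  then show ?thesis
    using that[of "N u" "N w"] pos u(2)[OF w(1)] by fastforce
qed

lemma closed_nball:
  fixes N :: "'a::euclidean_space \<Rightarrow> real"
  assumes "is_norm N"
  shows "closed (nball N x \<rho>)"
  unfolding nball_def
  by (intro closed_Collect_le continuous_on_compose2[OF is_norm_continuous[OF assms]])
     (auto intro!: continuous_intros)

lemma nball_borel [measurable]:
  fixes N :: "'a::euclidean_space \<Rightarrow> real"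
  assumes "is_norm N"
  shows "nball N x \<rho> \<in> sets borel"
  by (rule borel_closed[OF closed_nball[OF assms]])

text \<open>Since \<open>N\<close> is homogeneous, its balls are the affine images of its unit ball, so their volume scales
  as in the Euclidean case, with the volume of the unit ball of \<open>N\<close> as the constant.\<close>

lemma emeasure_nball:
  fixes N :: "'a::euclidean_space \<Rightarrow> real"
  assumes N: "is_norm N" and "0 \<le> \<rho>"
  shows "emeasure lborel (nball N x \<rho>) = ennreal (measure lborel (nball N 0 1) * \<rho> ^ DIM('a))"
proof (cases "\<rho> = 0")
  case True
  have "N y \<le> 0 \<longleftrightarrow> y = 0" for y
    using is_norm_nonneg[OF N, of y] is_norm_eq_0[OF N, of y] by auto
  then have "nball N x \<rho> = {x}"
    using True by (auto simp: nball_def)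
  then show ?thesis using True by simp
next
  case False
  then have \<rho>: "0 < \<rho>" using assms by simp
  obtain m K where m: "0 < m" "\<And>x. m * norm x \<le> N x"
    using is_norm_equivalent[OF N] by metis
  have "nball N 0 1 \<subseteq> cball 0 (1 / m)"
    using m(1) order_trans[OF m(2)] by (auto simp: nball_def field_simps)
  then have "emeasure lborel (nball N 0 1) \<le> emeasure lborel (cball (0::'a) (1 / m))"
    by (rule emeasure_mono) simp
  then have fin: "emeasure lborel (nball N 0 1) < \<infinity>"
    using emeasure_lborel_cball_finite order_le_less_trans by blast
  have "nball N x \<rho> = (\<lambda>y. \<rho> *\<^sub>R y + x) ` nball N 0 1"
  proof (intro set_eqI iffI)
    fix y assume "y \<in> nball N x \<rho>"
    then have "(y - x) /\<^sub>R \<rho> \<in> nball N 0 1"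
      using \<rho> is_norm_scaleR[OF N, of "inverse \<rho>" "y - x"]
      by (simp add: nball_def inverse_eq_divide)
    moreover have "y = \<rho> *\<^sub>R ((y - x) /\<^sub>R \<rho>) + x" using \<rho> by simp
    ultimately show "y \<in> (\<lambda>y. \<rho> *\<^sub>R y + x) ` nball N 0 1" by blast
  next
    fix y assume "y \<in> (\<lambda>y. \<rho> *\<^sub>R y + x) ` nball N 0 1"
    then show "y \<in> nball N x \<rho>"
      using \<rho> by (auto simp: nball_def is_norm_scaleR[OF N])
  qed
  then have "emeasure lborel (nball N x \<rho>) = emeasure lebesgue ((\<lambda>y. \<rho> *\<^sub>R y + x) ` nball N 0 1)"
    using nball_borel[OF N, of x \<rho>] by simp
  also have "\<dots> = ennreal (\<rho> ^ DIM('a)) * emeasure lborel (nball N 0 1)"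
    using emeasure_lebesgue_affine[of \<rho> x "nball N 0 1"] \<rho> nball_borel[OF N, of 0 1] by simp
  also have "emeasure lborel (nball N 0 1) = ennreal (measure lborel (nball N 0 1))"
    using fin by (intro emeasure_eq_ennreal_measure) auto
  finally show ?thesis
    using \<rho> by (simp add: ennreal_mult[symmetric] mult.commute)
qed

lemma measure_nball_pos:
  fixes N :: "'a::euclidean_space \<Rightarrow> real"
  assumes N: "is_norm N"
  shows "0 < measure lborel (nball N 0 1)"
proof -
  obtain K where K: "0 < K" "\<And>x. N x \<le> K * norm x"
    using is_norm_equivalent[OF N] by metis
  have sub: "ball 0 (1 / K) \<subseteq> nball N 0 1"
  proof
    fix x :: 'a assume "x \<in> ball 0 (1 / K)"
    then have "K * norm x \<le> 1" using K(1) by (simp add: field_simps)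
    then show "x \<in> nball N 0 1" using K(2)[of x] by (simp add: nball_def)
  qed
  have "0 < measure lborel (ball (0::'a) (1 / K))"
    using content_ball_pos[of "1 / K" "0::'a"] K(1) by simp
  then have "0 < emeasure lborel (ball (0::'a) (1 / K))"
    by (metis measure_def enn2real_0 not_gr_zero less_irrefl)
  also have "\<dots> \<le> emeasure lborel (nball N 0 1)"
    using sub nball_borel[OF N] by (intro emeasure_mono) auto
  finally show ?thesis
    using emeasure_nball[OF N, of 1 0] by (simp add: ennreal_less_zero_iff)
qed

lemma ndist_le: "finite A \<Longrightarrow> a \<in> A \<Longrightarrow> ndist N x A \<le> N (x - a)"
  unfolding ndist_def by (rule Min_le) auto

lemma ndist_attained:
  assumes "finite A" "A \<noteq> {}"
  obtains a where "a \<in> A" "ndist N x A = N (x - a)"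
proof -
  have "ndist N x A \<in> (\<lambda>a. N (x - a)) ` A"
    unfolding ndist_def using assms by (intro Min_in) auto
  then show ?thesis using that by blast
qed

lemma ndist_nonneg: "is_norm N \<Longrightarrow> finite A \<Longrightarrow> A \<noteq> {} \<Longrightarrow> 0 \<le> ndist N x A"
  by (metis ndist_attained is_norm_nonneg)

lemma ndist_triangle:
  assumes "is_norm N" "finite A" "A \<noteq> {}"
  shows "ndist N x A \<le> N (x - y) + ndist N y A"
proof -
  obtain a where a: "a \<in> A" "ndist N y A = N (y - a)"
    using ndist_attained assms(2,3) by metis
  show ?thesis
    using ndist_le[OF assms(2) a(1), of N x] is_norm_triangle_diff[OF assms(1), of x a y] a(2) by simp
qed

lemma ndist_eq_0_iff:
  assumes "is_norm N" "finite A" "A \<noteq> {}"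
  shows "ndist N x A = 0 \<longleftrightarrow> x \<in> A"
proof
  assume "ndist N x A = 0"
  then show "x \<in> A"
    using ndist_attained[OF assms(2,3), of N x] is_norm_eq_0[OF assms(1)] by auto
next
  assume "x \<in> A"
  then show "ndist N x A = 0"
    using ndist_le[OF assms(2), of x N x] ndist_nonneg[OF assms, of x] is_norm_eq_0[OF assms(1), of 0]
    by simp
qed

lemma ndist_borel_measurable:
  fixes N :: "real ^ 'd \<Rightarrow> real"
  assumes N: "is_norm N" and A: "finite A"
  shows "(\<lambda>x. ndist N x A) \<in> borel_measurable borel"
proof -
  note [measurable] = is_norm_borel_measurable[OF N]
  have "(\<lambda>x. Min ((\<lambda>i. N (x - i)) ` A)) \<in> borel_measurable borel"
    using A by measurable
  then show ?thesis by (simp add: ndist_def)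
qed

lemma ndist_dilated_set:
  assumes N: "is_norm N" and A: "finite A" "A \<noteq> {}" and \<theta>: "0 < \<theta>"
  shows "ndist N x (dilated_set \<theta> \<mu> A) = \<theta> * ndist N ((x - \<mu>) /\<^sub>R \<theta> + \<mu>) A"
proof -
  have "N (x - (\<mu> + \<theta> *\<^sub>R (a - \<mu>))) = \<theta> * N ((x - \<mu>) /\<^sub>R \<theta> + \<mu> - a)" for a
  proof -
    have "x - (\<mu> + \<theta> *\<^sub>R (a - \<mu>)) = \<theta> *\<^sub>R ((x - \<mu>) /\<^sub>R \<theta> + \<mu> - a)"
      using \<theta> by (simp add: algebra_simps)
    then show ?thesis using \<theta> by (simp add: is_norm_scaleR[OF N])
  qed
  then have "ndist N x (dilated_set \<theta> \<mu> A) = Min ((*) \<theta> ` (\<lambda>a. N ((x - \<mu>) /\<^sub>R \<theta> + \<mu> - a)) ` A)"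
    by (simp add: ndist_def dilated_set_def image_image)
  also have "\<dots> = \<theta> * ndist N ((x - \<mu>) /\<^sub>R \<theta> + \<mu>) A"
    unfolding ndist_def
    using A \<theta> by (intro mono_Min_commute[symmetric]) (auto intro!: monoI)
  finally show ?thesis .
qed

section \<open>Differentiation of measures along shrinking balls\<close>

text \<open>If \<open>\<nu>\<close> gives open neighbourhoods of \<open>E\<close> arbitrarily small mass, then the points of \<open>E\<close> around which
  \<open>\<nu>\<close> keeps density above \<open>c\<close> at arbitrarily small scales form a null set: by Vitali's covering
  theorem, disjoint balls on which \<open>\<nu>\<close> exceeds \<open>c\<close> times the volume cover almost all of them inside a
  neighbourhood \<open>U\<close> of \<open>E\<close>, so their total volume is at most \<open>\<nu> U / c\<close>.\<close>

lemma negligible_dense_points: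
  fixes \<nu> :: "'a::euclidean_space measure"
  assumes sets: "sets \<nu> = sets borel"
    and outer: "\<And>e. 0 < e \<Longrightarrow> \<exists>U. open U \<and> E \<subseteq> U \<and> emeasure \<nu> U < ennreal e"
    and "0 < c"
  defines "F \<equiv> {x \<in> E. \<forall>d>0. \<exists>\<rho>. 0 < \<rho> \<and> \<rho> < d \<and>
                   ennreal c * emeasure lborel (cball x \<rho>) < emeasure \<nu> (cball x \<rho>)}"
  shows "negligible F"
  unfolding negligible_outer_le
proof (intro allI impI)
  fix e :: real assume e: "0 < e"
  obtain U where U: "open U" "E \<subseteq> U" "emeasure \<nu> U < ennreal (c * e)"
    using outer[of "c * e"] e \<open>0 < c\<close> by auto
  let ?K = "{(x, \<rho>). 0 < \<rho> \<and> cball x \<rho> \<subseteq> U \<and>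
                   ennreal c * emeasure lborel (cball x \<rho>) < emeasure \<nu> (cball x \<rho>)}"
  obtain C where C: "countable C" "C \<subseteq> ?K"
      "pairwise (\<lambda>i j. disjnt (cball (fst i) (snd i)) (cball (fst j) (snd j))) C"
      "negligible (F - (\<Union>i\<in>C. cball (fst i) (snd i)))"
  proof (rule Vitali_covering_theorem_cballs[of ?K snd F fst])
    show "0 < snd i" if "i \<in> ?K" for i using that by auto
    fix x and d :: real assume x: "x \<in> F" and d: "0 < d"
    then have "x \<in> U" using U(2) by (auto simp: F_def)
    then obtain k where k: "0 < k" "cball x k \<subseteq> U"
      using U(1) open_contains_cball by blast
    obtain \<rho> where \<rho>: "0 < \<rho>" "\<rho> < min d k"
        "ennreal c * emeasure lborel (cball x \<rho>) < emeasure \<nu> (cball x \<rho>)"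
      using x d k(1) unfolding F_def by (auto dest!: spec[of _ "min d k"])
    then have "cball x \<rho> \<subseteq> U" using k(2) by force
    then show "\<exists>i. i \<in> ?K \<and> x \<in> cball (fst i) (snd i) \<and> snd i < d"
      using \<rho> by (intro exI[of _ "(x, \<rho>)"]) auto
  qed blast
  let ?B = "\<lambda>i. cball (fst i) (snd i) :: 'a set"
  have disj: "disjoint_family_on ?B C"
    using C(3) by (auto simp: disjoint_family_on_def pairwise_def disjnt_def)
  have "ennreal c * emeasure lborel (\<Union>i\<in>C. ?B i)
      = ennreal c * (\<integral>\<^sup>+i. emeasure lborel (?B i) \<partial>count_space C)"
    using C(1) disj by (subst emeasure_UN_countable) auto
  also have "\<dots> = (\<integral>\<^sup>+i. ennreal c * emeasure lborel (?B i) \<partial>count_space C)"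
    by (simp add: nn_integral_cmult)
  also have "\<dots> \<le> (\<integral>\<^sup>+i. emeasure \<nu> (?B i) \<partial>count_space C)"
    using C(2) by (intro nn_integral_mono) auto
  also have "\<dots> = emeasure \<nu> (\<Union>i\<in>C. ?B i)"
    using C(1) disj by (subst emeasure_UN_countable) (auto simp: sets)
  also have "\<dots> \<le> emeasure \<nu> U"
    using C(2) U(1) by (intro emeasure_mono) (auto simp: sets subset_iff)
  also note U(3)
  finally have "ennreal c * emeasure lborel (\<Union>i\<in>C. ?B i) < ennreal c * ennreal e"
    using \<open>0 < c\<close> e by (simp add: ennreal_mult)
  then have small: "emeasure lborel (\<Union>i\<in>C. ?B i) < ennreal e"
    using mult_left_mono[of "ennreal e" "emeasure lborel (\<Union>i\<in>C. ?B i)" "ennreal c"]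
    by (auto simp: not_le[symmetric])
  have meas: "(\<Union>i\<in>C. ?B i) \<in> sets borel"
    using C(1) by (intro sets.countable_UN'') auto
  have T: "(\<Union>i\<in>C. ?B i) \<in> lmeasurable"
    using small meas by (intro fmeasurableI) (auto intro: order_less_trans[OF _ ennreal_less_top])
  have mT: "measure lebesgue (\<Union>i\<in>C. ?B i) \<le> e"
    using small meas e by (simp add: measure_def enn2real_leI order_less_imp_le)
  let ?T = "(\<Union>i\<in>C. ?B i) \<union> (F - (\<Union>i\<in>C. ?B i))"
  show "\<exists>T. F \<subseteq> T \<and> T \<in> lmeasurable \<and> measure lebesgue T \<le> e"
  proof (intro exI[of _ ?T] conjI)
    show "?T \<in> lmeasurable"
      using T negligible_imp_measurable[OF C(4)] by (rule fmeasurable.Un)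
    show "measure lebesgue ?T \<le> e"
      using measure_Un_le[of "\<Union>i\<in>C. ?B i" lebesgue "F - (\<Union>i\<in>C. ?B i)"] mT
        fmeasurableD[OF T] fmeasurableD[OF negligible_imp_measurable[OF C(4)]]
        negligible_imp_measure0[OF C(4)] by simp
  qed auto
qed

text \<open>The balls of \<open>N\<close> lie in Euclidean balls of comparable volume, so density zero carries over to them.\<close>

lemma AE_nball_density_zero:
  fixes \<nu> :: "'a::euclidean_space measure" and N :: "'a \<Rightarrow> real"
  assumes N: "is_norm N" and sets: "sets \<nu> = sets borel"
    and outer: "\<And>e. 0 < e \<Longrightarrow> \<exists>U. open U \<and> E \<subseteq> U \<and> emeasure \<nu> U < ennreal e"
  shows "AE x in lborel. x \<in> E \<longrightarrow> (\<forall>c>0. \<forall>\<^sub>F \<rho> in at_right 0.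
           emeasure \<nu> (nball N x \<rho>) \<le> ennreal c * emeasure lborel (nball N x \<rho>))"
proof -
  obtain m where m: "0 < m" "\<And>x. m * norm x \<le> N x"
    using is_norm_equivalent[OF N] by metis
  obtain w where w: "0 < w" "\<And>x \<rho>. 0 < \<rho> \<Longrightarrow>
      emeasure lborel (cball x (\<rho> / m)) = ennreal w * emeasure lborel (nball N x \<rho>)"
  proof
    let ?u = "measure lborel (nball norm (0::'a) 1)" and ?v = "measure lborel (nball N 0 1)"
    have n: "is_norm (norm :: 'a \<Rightarrow> real)"
      by (auto simp: is_norm_def norm_triangle_ineq)
    have cb: "cball x t = nball norm x t" for x :: 'a and t
      by (auto simp: nball_def dist_norm norm_minus_commute)
    have pos: "0 < ?u" "0 < ?v" using measure_nball_pos[OF n] measure_nball_pos[OF N] by auto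
    show "0 < ?u / (?v * m ^ DIM('a))" using pos m(1) by simp
    fix x :: 'a and \<rho> :: real assume \<rho>: "0 < \<rho>"
    show "emeasure lborel (cball x (\<rho> / m))
        = ennreal (?u / (?v * m ^ DIM('a))) * emeasure lborel (nball N x \<rho>)"
      using \<rho> m(1) pos unfolding cb
      by (simp add: emeasure_nball[OF n] emeasure_nball[OF N] ennreal_mult[symmetric] power_divide)
  qed
  let ?F = "\<lambda>c. {x \<in> E. \<forall>d>0. \<exists>\<rho>. 0 < \<rho> \<and> \<rho> < d \<and>
                   ennreal c * emeasure lborel (cball x \<rho>) < emeasure \<nu> (cball x \<rho>)}"
  have "negligible (\<Union>k::nat. ?F (1 / Suc k))"
    using negligible_dense_points[OF sets outer] by (intro negligible_countable_Union) auto
  then have "AE x in lebesgue. x \<notin> (\<Union>k::nat. ?F (1 / Suc k))"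
    by (intro AE_not_in) (simp add: negligible_iff_null_sets)
  then have "AE x in lborel. x \<notin> (\<Union>k::nat. ?F (1 / Suc k))"
    by (simp add: AE_completion_iff)
  then show ?thesis
  proof (rule eventually_mono, intro impI allI)
    fix x and c :: real
    assume x: "x \<notin> (\<Union>k::nat. ?F (1 / Suc k))" "x \<in> E" and c: "0 < c"
    have "0 < c / w" using c w by simp
    then obtain k :: nat where k: "1 / Suc k < c / w"
      using nat_approx_posE by blast
    obtain d where d: "0 < d" "\<And>\<rho>. 0 < \<rho> \<Longrightarrow> \<rho> < d \<Longrightarrow>
        emeasure \<nu> (cball x \<rho>) \<le> ennreal (1 / Suc k) * emeasure lborel (cball x \<rho>)"
    proof -
      have "x \<notin> ?F (1 / Suc k)" using x(1) by blast
      then show ?thesis using x(2) that by (fastforce simp: not_less)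
    qed
    show "\<forall>\<^sub>F \<rho> in at_right 0.
           emeasure \<nu> (nball N x \<rho>) \<le> ennreal c * emeasure lborel (nball N x \<rho>)"
      unfolding eventually_at_right_field
    proof (intro exI[of _ "d * m"] conjI allI impI)
      show "0 < d * m" using d m by simp
      fix \<rho> :: real assume \<rho>: "0 < \<rho>" "\<rho> < d * m"
      have "nball N x \<rho> \<subseteq> cball x (\<rho> / m)"
        using m(1) order_trans[OF m(2)]
        by (auto simp: nball_def dist_norm norm_minus_commute field_simps)
      then have "emeasure \<nu> (nball N x \<rho>) \<le> emeasure \<nu> (cball x (\<rho> / m))"
        by (rule emeasure_mono) (simp add: sets)
      also have "\<dots> \<le> ennreal (1 / Suc k) * emeasure lborel (cball x (\<rho> / m))"
        using \<rho> m by (intro d(2)) (auto simp: field_simps)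
      also have "\<dots> = ennreal (w / Suc k) * emeasure lborel (nball N x \<rho>)"
        using w \<rho> by (simp add: ennreal_mult[symmetric] mult.assoc[symmetric])
      also have "\<dots> \<le> ennreal c * emeasure lborel (nball N x \<rho>)"
        using k w by (intro mult_right_mono ennreal_leI) (auto simp: field_simps)
      finally show "emeasure \<nu> (nball N x \<rho>) \<le> ennreal c * emeasure lborel (nball N x \<rho>)" .
    qed
  qed
qed


text \<open>Lebesgue's differentiation theorem for the balls of an arbitrary norm. For a rational level \<open>q\<close>, the
  part of \<open>P\<close> outside \<open>{f < q}\<close> has density zero at almost every point of \<open>{f < q}\<close>, and the part of
  \<open>P\<close> inside contributes density at most \<open>q\<close>; this bounds the upper density of \<open>P\<close> by \<open>f\<close>. The lower
  density is treated in the same way with the complement of \<open>{q < f}\<close>. Countably many levels \<open>q\<close>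
  suffice.\<close>

theorem lebesgue_differentiation_nball:
  fixes f :: "'a::euclidean_space \<Rightarrow> real" and N :: "'a \<Rightarrow> real"
  assumes N: "is_norm N" and f [measurable]: "f \<in> borel_measurable borel" and f0: "\<And>x. 0 \<le> f x"
    and fin: "finite_measure (density lborel (\<lambda>x. ennreal (f x)))"
  defines "P \<equiv> density lborel (\<lambda>x. ennreal (f x))"
  shows "AE x in lborel. ((\<lambda>\<rho>. measure P (nball N x \<rho>) / measure lborel (nball N x \<rho>)) \<longlongrightarrow> f x)
           (at_right 0)"
proof -
  interpret P: finite_measure P unfolding P_def by (rule fin)
  note nb [measurable] = nball_borel[OF N]
  have sP [simp, measurable_cong]: "sets P = sets borel" by (simp add: P_def)
  let ?L = "\<lambda>x \<rho>. measure lborel (nball N x \<rho>)"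
  have eL: "emeasure lborel (nball N x \<rho>) = ennreal (?L x \<rho>)" and Lpos: "0 < ?L x \<rho>" if "0 < \<rho>" for x \<rho>
    using emeasure_nball[OF N, of \<rho> x] measure_nball_pos[OF N] that
    by (auto simp: measure_def)
  have upper: "AE x in lborel. f x < q \<longrightarrow> (\<forall>c>0. \<forall>\<^sub>F \<rho> in at_right 0.
      measure P (nball N x \<rho>) \<le> (q + c) * ?L x \<rho>)" for q
  proof -
    let ?E = "{x. f x < q}"
    have E [measurable]: "?E \<in> sets borel" by measurable
    \<comment> \<open>the part of \<open>P\<close> outside \<open>{f < q}\<close>; as it is finite, it is outer regular\<close>
    define \<nu> where "\<nu> = density P (indicator (- ?E))"
    have s\<nu>: "sets \<nu> = sets borel" by (simp add: \<nu>_def)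
    have em: "emeasure \<nu> A = emeasure P (A - ?E)" if "A \<in> sets borel" for A
      using that unfolding \<nu>_def
      by (subst emeasure_density) (auto simp: indicator_inter_arith[symmetric] Diff_eq Int_commute)
    have "emeasure \<nu> (space \<nu>) \<noteq> \<infinity>"
      using em[of UNIV] sets_eq_imp_space_eq[OF s\<nu>] by (simp add: P.emeasure_finite)
    then have "emeasure \<nu> ?E = (INF U \<in> {U. ?E \<subseteq> U \<and> open U}. emeasure \<nu> U)"
      using s\<nu> E by (intro outer_regular) auto
    then have outer: "\<exists>U. open U \<and> ?E \<subseteq> U \<and> emeasure \<nu> U < ennreal e" if "0 < e" for e
      using em[OF E] that INF_less_iff[of "emeasure \<nu>" "{U. ?E \<subseteq> U \<and> open U}" "ennreal e"] by auto
    have "AE x in lborel. x \<in> ?E \<longrightarrow> (\<forall>c>0. \<forall>\<^sub>F \<rho> in at_right 0.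
           emeasure \<nu> (nball N x \<rho>) \<le> ennreal c * emeasure lborel (nball N x \<rho>))"
      by (rule AE_nball_density_zero[OF N s\<nu> outer])
    then show ?thesis
    proof (rule eventually_mono, intro impI allI)
      fix x and c :: real
      assume H: "x \<in> ?E \<longrightarrow> (\<forall>c>0. \<forall>\<^sub>F \<rho> in at_right 0.
           emeasure \<nu> (nball N x \<rho>) \<le> ennreal c * emeasure lborel (nball N x \<rho>))"
        and x: "f x < q" and c: "0 < c"
      then have "\<forall>\<^sub>F \<rho> in at_right 0.
           emeasure \<nu> (nball N x \<rho>) \<le> ennreal c * emeasure lborel (nball N x \<rho>)" by auto
      moreover have "\<forall>\<^sub>F \<rho> in at_right 0. (0::real) < \<rho>"
        by (rule eventually_at_right_less)
      ultimately show "\<forall>\<^sub>F \<rho> in at_right 0. measure P (nball N x \<rho>) \<le> (q + c) * ?L x \<rho>"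
      proof eventually_elim
        fix \<rho> :: real
        assume \<nu>: "emeasure \<nu> (nball N x \<rho>) \<le> ennreal c * emeasure lborel (nball N x \<rho>)" and \<rho>: "0 < \<rho>"
        have q: "0 \<le> q" using f0[of x] x by simp
        have "emeasure P (nball N x \<rho>)
            \<le> emeasure P (nball N x \<rho> \<inter> ?E) + emeasure P (nball N x \<rho> - ?E)"
          by (subst plus_emeasure) (auto intro!: emeasure_mono)
        also have "emeasure P (nball N x \<rho> \<inter> ?E)
            \<le> (\<integral>\<^sup>+ y. ennreal q * indicator (nball N x \<rho>) y \<partial>lborel)"
          unfolding P_def
          by (subst emeasure_density) (auto intro!: nn_integral_mono ennreal_leI simp: indicator_def)
        also have "\<dots> = ennreal (q * ?L x \<rho>)"
          using q \<rho> by (simp add: nn_integral_cmult eL ennreal_mult)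
        also have "emeasure P (nball N x \<rho> - ?E) \<le> ennreal (c * ?L x \<rho>)"
          using \<nu> em[OF nb] c \<rho> by (simp add: eL ennreal_mult)
        finally have "emeasure P (nball N x \<rho>) \<le> ennreal ((q + c) * ?L x \<rho>)"
          using q c by (simp add: ennreal_plus[symmetric] distrib_right add_mono del: ennreal_plus)
        then show "measure P (nball N x \<rho>) \<le> (q + c) * ?L x \<rho>"
          using q c by (simp add: P.emeasure_eq_measure)
      qed
    qed
  qed
  have lower: "AE x in lborel. q < f x \<longrightarrow> (\<forall>c>0. \<forall>\<^sub>F \<rho> in at_right 0.
      q * ?L x \<rho> \<le> measure P (nball N x \<rho>) + q * c * ?L x \<rho>)" if q: "0 \<le> q" for q
  proof -
    let ?E = "{x. q < f x}"
    have E [measurable]: "?E \<in> sets borel" by measurable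
    \<comment> \<open>volume outside \<open>{q < f}\<close>: it may be infinite, but Lebesgue measure approximates every Borel set from outside by open sets\<close>
    define \<nu> where "\<nu> = density lborel (indicator (- ?E) :: 'a \<Rightarrow> ennreal)"
    have s\<nu>: "sets \<nu> = sets borel" by (simp add: \<nu>_def)
    have em: "emeasure \<nu> A = emeasure lborel (A - ?E)" if "A \<in> sets borel" for A
      using that unfolding \<nu>_def
      by (subst emeasure_density) (auto simp: indicator_inter_arith[symmetric] Diff_eq Int_commute)
    have outer: "\<exists>U. open U \<and> ?E \<subseteq> U \<and> emeasure \<nu> U < ennreal e" if "0 < e" for e
    proof -
      have "?E \<in> sets lebesgue" using E by simp
      from sets_lebesgue_outer_open[OF this that] obtain U
        where U: "open U" "?E \<subseteq> U" "emeasure lebesgue (U - ?E) < ennreal e" by metis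
      then have "emeasure \<nu> U < ennreal e"
        using em[of U] by simp
      then show ?thesis using U by blast
    qed
    have "AE x in lborel. x \<in> ?E \<longrightarrow> (\<forall>c>0. \<forall>\<^sub>F \<rho> in at_right 0.
           emeasure \<nu> (nball N x \<rho>) \<le> ennreal c * emeasure lborel (nball N x \<rho>))"
      by (rule AE_nball_density_zero[OF N s\<nu> outer])
    then show ?thesis
    proof (rule eventually_mono, intro impI allI)
      fix x and c :: real
      assume H: "x \<in> ?E \<longrightarrow> (\<forall>c>0. \<forall>\<^sub>F \<rho> in at_right 0.
           emeasure \<nu> (nball N x \<rho>) \<le> ennreal c * emeasure lborel (nball N x \<rho>))"
        and x: "q < f x" and c: "0 < c"
      then have "\<forall>\<^sub>F \<rho> in at_right 0.
           emeasure \<nu> (nball N x \<rho>) \<le> ennreal c * emeasure lborel (nball N x \<rho>)" by auto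
      moreover have "\<forall>\<^sub>F \<rho> in at_right 0. (0::real) < \<rho>"
        by (rule eventually_at_right_less)
      ultimately show "\<forall>\<^sub>F \<rho> in at_right 0.
          q * ?L x \<rho> \<le> measure P (nball N x \<rho>) + q * c * ?L x \<rho>"
      proof eventually_elim
        fix \<rho> :: real
        assume \<nu>: "emeasure \<nu> (nball N x \<rho>) \<le> ennreal c * emeasure lborel (nball N x \<rho>)" and \<rho>: "0 < \<rho>"
        have "emeasure lborel (nball N x \<rho>)
            \<le> emeasure lborel (nball N x \<rho> \<inter> ?E) + emeasure lborel (nball N x \<rho> - ?E)"
          by (subst plus_emeasure) (auto intro!: emeasure_mono)
        then have "ennreal q * emeasure lborel (nball N x \<rho>)
            \<le> ennreal q * (emeasure lborel (nball N x \<rho> \<inter> ?E) + emeasure lborel (nball N x \<rho> - ?E))"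
          by (rule mult_left_mono) simp
        also have "\<dots> = ennreal q * emeasure lborel (nball N x \<rho> \<inter> ?E)
            + ennreal q * emeasure lborel (nball N x \<rho> - ?E)"
          by (rule distrib_left)
        also have "ennreal q * emeasure lborel (nball N x \<rho> \<inter> ?E)
            = (\<integral>\<^sup>+ y. ennreal q * indicator (nball N x \<rho> \<inter> ?E) y \<partial>lborel)"
          by (simp add: nn_integral_cmult)
        also have "\<dots> \<le> emeasure P (nball N x \<rho>)"
          unfolding P_def
          by (subst emeasure_density) (auto intro!: nn_integral_mono ennreal_leI simp: indicator_def)
        also have "ennreal q * emeasure lborel (nball N x \<rho> - ?E) \<le> ennreal q * ennreal (c * ?L x \<rho>)"
          using \<nu> em[OF nb] c \<rho> by (intro mult_left_mono) (auto simp: eL ennreal_mult)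
        finally have "ennreal (q * ?L x \<rho>) \<le> ennreal (measure P (nball N x \<rho>) + q * c * ?L x \<rho>)"
          using q c \<rho> by (simp add: eL P.emeasure_eq_measure ennreal_mult[symmetric] mult.assoc add_right_mono)
        then show "q * ?L x \<rho> \<le> measure P (nball N x \<rho>) + q * c * ?L x \<rho>"
          using q c by (subst (asm) ennreal_le_iff) auto
      qed
    qed
  qed
  have "AE x in lborel. \<forall>q\<in>\<rat>. f x < q \<longrightarrow> (\<forall>c>0. \<forall>\<^sub>F \<rho> in at_right 0.
      measure P (nball N x \<rho>) \<le> (q + c) * ?L x \<rho>)"
    by (intro AE_ball_countable' upper countable_rat)
  moreover have "AE x in lborel. \<forall>q\<in>\<rat> \<inter> {0..}. q < f x \<longrightarrow> (\<forall>c>0. \<forall>\<^sub>F \<rho> in at_right 0.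
      q * ?L x \<rho> \<le> measure P (nball N x \<rho>) + q * c * ?L x \<rho>)"
    by (intro AE_ball_countable' lower countable_Int1 countable_rat) auto
  ultimately show ?thesis
  proof eventually_elim
    fix x
    assume up: "\<forall>q\<in>\<rat>. f x < q \<longrightarrow> (\<forall>c>0. \<forall>\<^sub>F \<rho> in at_right 0.
        measure P (nball N x \<rho>) \<le> (q + c) * ?L x \<rho>)"
      and lo: "\<forall>q\<in>\<rat> \<inter> {0..}. q < f x \<longrightarrow> (\<forall>c>0. \<forall>\<^sub>F \<rho> in at_right 0.
        q * ?L x \<rho> \<le> measure P (nball N x \<rho>) + q * c * ?L x \<rho>)"
    have pos: "\<forall>\<^sub>F \<rho> in at_right 0. (0::real) < \<rho>"
      by (rule eventually_at_right_less)
    show "((\<lambda>\<rho>. measure P (nball N x \<rho>) / ?L x \<rho>) \<longlongrightarrow> f x) (at_right 0)"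
    proof (rule order_tendstoI)
      fix a assume a: "f x < a"
      obtain q where q: "q \<in> \<rat>" "f x < q" "q < a"
        using Rats_dense_in_real[OF a] by blast
      define c where "c = (a - q) / 2"
      have c: "0 < c" "q + c < a" using q by (auto simp: c_def field_simps)
      have "\<forall>\<^sub>F \<rho> in at_right 0. measure P (nball N x \<rho>) \<le> (q + c) * ?L x \<rho>"
        using up q c by blast
      then show "\<forall>\<^sub>F \<rho> in at_right 0. measure P (nball N x \<rho>) / ?L x \<rho> < a"
        using pos
      proof eventually_elim
        fix \<rho> :: real assume h: "measure P (nball N x \<rho>) \<le> (q + c) * ?L x \<rho>" and "0 < \<rho>"
        then have L: "0 < ?L x \<rho>" using Lpos by blast
        have "(q + c) * ?L x \<rho> < a * ?L x \<rho>" using c(2) L by simp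
        from order_le_less_trans[OF h this] show "measure P (nball N x \<rho>) / ?L x \<rho> < a"
          using L by (simp add: pos_divide_less_eq)
      qed
    next
      fix a assume a: "a < f x"
      show "\<forall>\<^sub>F \<rho> in at_right 0. a < measure P (nball N x \<rho>) / ?L x \<rho>"
      proof (cases "a < 0")
        case True
        show ?thesis
          using pos
        proof eventually_elim
          fix \<rho> :: real
          have "0 \<le> measure P (nball N x \<rho>) / ?L x \<rho>" by simp
          then show "a < measure P (nball N x \<rho>) / ?L x \<rho>" using True by linarith
        qed
      next
        case False
        obtain q where q: "q \<in> \<rat>" "a < q" "q < f x"
          using Rats_dense_in_real[OF a] by blast
        \<comment> \<open>the tolerance is relative to \<open>q\<close>, because the lower bound loses \<open>q * c\<close>\<close>
        define c where "c = (q - a) / (2 * q)"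
        have q0: "0 < q" using q False by simp
        have c: "0 < c" "q * c < q - a" using q q0 by (auto simp: c_def field_simps)
        have "\<forall>\<^sub>F \<rho> in at_right 0. q * ?L x \<rho> \<le> measure P (nball N x \<rho>) + q * c * ?L x \<rho>"
          using lo q c q0 by auto
        then show ?thesis
          using pos
        proof eventually_elim
          fix \<rho> :: real
          assume h: "q * ?L x \<rho> \<le> measure P (nball N x \<rho>) + q * c * ?L x \<rho>" and "0 < \<rho>"
          then have L: "0 < ?L x \<rho>" using Lpos by blast
          have "q * c * ?L x \<rho> < (q - a) * ?L x \<rho>" using c(2) L by simp
          with h have "a * ?L x \<rho> < measure P (nball N x \<rho>)"
            unfolding left_diff_distrib by linarith
          then show "a < measure P (nball N x \<rho>) / ?L x \<rho>"
            using L by (simp add: pos_less_divide_eq)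
        qed
      qed
    qed
  qed
qed

section \<open>Point sets adapted to a moment condition\<close>

text \<open>The map \<open>\<phi> u = (1 - u) powr (- 1 / \<delta>) - 1\<close> from \<open>[0, 1)\<close> onto \<open>[0, \<infinity>)\<close> satisfies
  \<open>\<phi>' = (1 + \<phi>) powr (1 + \<delta>) / \<delta>\<close>. The images of equidistant points are therefore spaced, around \<open>t\<close>,
  by no more than \<open>(1 + t) powr (1 + \<delta>) / (\<delta> m)\<close>, and finitely many points reach far enough to serve
  the whole line. The set is made symmetric for negative \<open>t\<close>.\<close>

lemma real_grid_polynomial_spacing:
  assumes \<delta>: "0 < \<delta>" and m: "0 < m"
  obtains G :: "real set"
  where "finite G" "G \<noteq> {}" "card G \<le> 2 * m - 1"
    "\<And>t. \<exists>g\<in>G. \<bar>t - g\<bar> \<le> (1 + \<bar>t\<bar>) powr (1 + \<delta>) / (\<delta> * m)"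
proof -
  define \<phi> where "\<phi> u = (1 - u) powr (- (1 / \<delta>)) - 1" for u :: real
  define G where "G = (\<lambda>j. \<phi> (j / m)) ` {..<m} \<union> (\<lambda>j. - \<phi> (j / m)) ` {1..<m}"
  have card: "card G \<le> 2 * m - 1"
  proof -
    have "card G \<le> card ((\<lambda>j. \<phi> (j / m)) ` {..<m}) + card ((\<lambda>j. - \<phi> (j / m)) ` {1..<m})"
      unfolding G_def by (rule card_Un_le)
    also have "\<dots> \<le> m + (m - 1)"
      using card_image_le[of "{..<m}" "\<lambda>j. \<phi> (real j / m)"]
        card_image_le[of "{1..<m}" "\<lambda>j. - \<phi> (real j / m)"] by simp
    finally show ?thesis using m by simp
  qed
  have \<phi>0: "\<phi> 0 = 0" by (simp add: \<phi>_def)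
  have neg: "- g \<in> G" if "g \<in> G" for g
  proof -
    from that consider j where "j < m" "g = \<phi> (j / m)" | j where "j \<in> {1..<m}" "g = - \<phi> (j / m)"
      by (auto simp: G_def)
    then show ?thesis
    proof cases
      case 1
      show ?thesis
      proof (cases "j = 0")
        case True
        then have "g = 0" using 1 \<phi>0 by simp
        then show ?thesis using that by simp
      next
        case False
        then show ?thesis unfolding G_def using 1 by (intro UnI2 image_eqI[of _ _ j]) auto
      qed
    next
      case 2
      then show ?thesis by (auto simp: G_def)
    qed
  qed
  have nonneg: "\<exists>g\<in>G. \<bar>t - g\<bar> \<le> (1 + t) powr (1 + \<delta>) / (\<delta> * m)" if t: "0 \<le> t" for t
  proof -
    define u where "u = 1 - (1 + t) powr (- \<delta>)"
    have u: "0 \<le> u" "u < 1"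
      using t \<delta> ge_one_powr_ge_zero[of "1 + t" \<delta>]
      by (auto simp: u_def powr_minus inverse_le_1_iff)
    have \<phi>u: "\<phi> u = t"
      using t \<delta> by (simp add: \<phi>_def u_def powr_powr)
    \<comment> \<open>the grid point below \<open>t\<close>: even for \<open>u\<close> close to \<open>1\<close> it exists, as \<open>j < m\<close>\<close>
    define j where "j = nat \<lfloor>u * m\<rfloor>"
    have j: "real j \<le> u * m" "u * m < real j + 1"
      using u m by (auto simp: j_def)
    then have "real j < real m"
      using u m by (smt (verit) mult_le_cancel_right1 of_nat_0_less_iff)
    then have gG: "\<phi> (j / m) \<in> G" by (auto simp: G_def)
    let ?v = "real j / m"
    have v: "0 \<le> ?v" "?v \<le> u" "u - ?v \<le> 1 / m"
    proof -
      show "0 \<le> ?v" by simp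
      show "?v \<le> u" using j m by (simp add: pos_divide_le_eq)
      have "u \<le> (real j + 1) / m" using j m by (simp add: pos_le_divide_eq)
      then show "u - ?v \<le> 1 / m" by (simp add: add_divide_distrib)
    qed
    have "\<bar>t - \<phi> ?v\<bar> \<le> (1 + t) powr (1 + \<delta>) / (\<delta> * m)"
    proof (cases "?v = u")
      case True
      then show ?thesis using \<phi>u \<delta> by simp
    next
      case False
      then have vu: "?v < u" using v by simp
      have der: "(\<phi> has_real_derivative (1 / \<delta>) * (1 - x) powr (- (1 / \<delta>) - 1)) (at x)"
        if "x \<le> u" for x
        unfolding \<phi>_def using that u \<delta>
        by (auto intro!: derivative_eq_intros simp: powr_diff)
      obtain z where z: "?v < z" "z < u"
          "\<phi> u - \<phi> ?v = (u - ?v) * ((1 / \<delta>) * (1 - z) powr (- (1 / \<delta>) - 1))"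
        using MVT2[OF vu, of \<phi> "\<lambda>x. (1 / \<delta>) * (1 - x) powr (- (1 / \<delta>) - 1)"] der by auto
      have "(1 - z) powr (- (1 / \<delta>) - 1) \<le> (1 - u) powr (- (1 / \<delta>) - 1)"
        using z u divide_pos_pos[OF zero_less_one \<delta>] by (intro powr_mono2') linarith+
      also have "(1 - u) powr (- (1 / \<delta>) - 1) = (1 + t) powr (1 + \<delta>)"
      proof -
        have "- \<delta> * (- (1 / \<delta>) - 1) = 1 + \<delta>" using \<delta> by (simp add: field_simps)
        then show ?thesis unfolding u_def by (simp only: diff_diff_eq2 add_diff_cancel_left' powr_powr)
      qed
      finally have d: "(1 - z) powr (- (1 / \<delta>) - 1) \<le> (1 + t) powr (1 + \<delta>)" .
      have "\<phi> u - \<phi> ?v \<le> (1 / m) * ((1 / \<delta>) * (1 + t) powr (1 + \<delta>))"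
        unfolding z(3) using v d \<delta> m by (intro mult_mono) auto
      moreover have "0 \<le> \<phi> u - \<phi> ?v"
        unfolding z(3) using v \<delta> by simp
      ultimately show ?thesis using \<phi>u by (simp add: mult.commute)
    qed
    then show ?thesis using gG by blast
  qed
  show ?thesis
  proof
    show "finite G" "G \<noteq> {}" using m by (auto simp: G_def)
    show "card G \<le> 2 * m - 1" by (rule card)
    fix t :: real
    show "\<exists>g\<in>G. \<bar>t - g\<bar> \<le> (1 + \<bar>t\<bar>) powr (1 + \<delta>) / (\<delta> * m)"
    proof (cases "0 \<le> t")
      case True
      then show ?thesis using nonneg[of t] by simp
    next
      case False
      then obtain g where g: "g \<in> G" "\<bar>- t - g\<bar> \<le> (1 + \<bar>t\<bar>) powr (1 + \<delta>) / (\<delta> * m)"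
        using nonneg[of "- t"] by auto
      moreover have "\<bar>t - - g\<bar> = \<bar>- t - g\<bar>" by simp
      ultimately show ?thesis using neg[OF g(1)] by metis
    qed
  qed
qed

text \<open>Products of the one-dimensional sets above. Letting the mesh grow polynomially at infinity gives one
  set of \<open>n\<close> points that is good everywhere, at the price of a weight which a moment condition
  integrates.\<close>

lemma quantizer_polynomial_spacing:
  fixes N :: "real ^ 'd \<Rightarrow> real"
  assumes N: "is_norm N" and \<delta>: "0 < \<delta>"
  obtains C where "0 < C"
    "\<And>n. 1 \<le> n \<Longrightarrow> \<exists>A\<in>quantizers n. \<forall>x. ndist N x A \<le> C * n powr (- (1 / CARD('d))) * (1 + N x) powr (1 + \<delta>)"
proof -
  obtain m K where mK: "0 < m" "0 < K" "\<And>x. m * norm x \<le> N x" "\<And>x. N x \<le> K * norm x"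
    using is_norm_equivalent[OF N] by metis
  define d where "d = CARD('d)"
  have d: "0 < d" by (simp add: d_def)
  define c where "c = max 1 (1 / m)"
  define C where "C = K * d * (4 / \<delta>) * c powr (1 + \<delta>)"
  show ?thesis
  proof
    show "0 < C" using mK d \<delta> by (auto simp: C_def c_def intro!: mult_pos_pos)
    fix n :: nat assume n: "1 \<le> n"
    define y where "y = real n powr (1 / d)"
    have y: "1 \<le> y" "y ^ d = n"
      using n d ge_one_powr_ge_zero[of "real n" "1 / d"]
      by (auto simp: y_def powr_realpow[symmetric] powr_powr)
    \<comment> \<open>\<open>p\<close> points are available per axis, and \<open>2 k - 1\<close> is the largest odd number not above \<open>p\<close>\<close>
    define p where "p = nat \<lfloor>y\<rfloor>"
    have p: "1 \<le> p" "real p \<le> y" "y < real p + 1"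
      using y by (auto simp: p_def le_nat_iff le_floor_iff)
    define k where "k = (p + 1) div 2"
    have k: "0 < k" "2 * k - 1 \<le> p" "p \<le> 2 * k"
      using p by (auto simp: k_def)
    have yk: "y \<le> 4 * k"
    proof -
      have "real p \<le> 2 * real k" "1 \<le> real k" using k by linarith+
      then show ?thesis using p(3) by linarith
    qed
    obtain G where G: "finite G" "G \<noteq> {}" "card G \<le> 2 * k - 1"
        "\<And>t. \<exists>g\<in>G. \<bar>t - g\<bar> \<le> (1 + \<bar>t\<bar>) powr (1 + \<delta>) / (\<delta> * k)"
      using real_grid_polynomial_spacing[OF \<delta> k(1)] by metis
    define A :: "(real ^ 'd) set" where "A = vec_lambda ` (UNIV \<rightarrow>\<^sub>E G)"
    have fin: "finite (UNIV \<rightarrow>\<^sub>E G :: ('d \<Rightarrow> real) set)"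
      using G(1) by (intro finite_PiE) auto
    have "card A \<le> card (UNIV \<rightarrow>\<^sub>E G :: ('d \<Rightarrow> real) set)"
      unfolding A_def by (rule card_image_le[OF fin])
    also have "\<dots> = card G ^ d" by (simp add: card_PiE d_def)
    also have "\<dots> \<le> p ^ d" using G(3) k(2) by (intro power_mono) auto
    also have "\<dots> \<le> n"
    proof -
      have "real p ^ d \<le> y ^ d" using p(2) by (intro power_mono) auto
      then show ?thesis unfolding y(2) by (simp flip: of_nat_power)
    qed
    finally have Aq: "A \<in> quantizers n"
      using fin G(2) by (auto simp: quantizers_def A_def PiE_eq_empty_iff)
    have "ndist N x A \<le> C * n powr (- (1 / d)) * (1 + N x) powr (1 + \<delta>)" for x
    proof -
      obtain g where g: "\<And>i. g i \<in> G" "\<And>i. \<bar>x $ i - g i\<bar> \<le> (1 + \<bar>x $ i\<bar>) powr (1 + \<delta>) / (\<delta> * k)"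
      proof -
        have "\<forall>i. \<exists>g. g \<in> G \<and> \<bar>x $ i - g\<bar> \<le> (1 + \<bar>x $ i\<bar>) powr (1 + \<delta>) / (\<delta> * k)"
          using G(4) by blast
        then show ?thesis using that by metis
      qed
      have gA: "vec_lambda g \<in> A" using g(1) by (auto simp: A_def)
      have coord: "\<bar>x $ i - g i\<bar> \<le> (4 / \<delta>) * c powr (1 + \<delta>) * ((1 + N x) powr (1 + \<delta>) / y)" for i
      proof -
        have "m * \<bar>x $ i\<bar> \<le> N x"
          using component_le_norm_cart[of x i] mK(1,3) by (meson mult_left_mono order_trans less_imp_le)
        then have "\<bar>x $ i\<bar> \<le> (1 / m) * N x" using mK(1) by (simp add: field_simps)
        also have "\<dots> \<le> c * N x"
          using is_norm_nonneg[OF N] by (intro mult_right_mono) (auto simp: c_def)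
        finally have "1 + \<bar>x $ i\<bar> \<le> c * (1 + N x)" by (simp add: c_def distrib_left)
        then have "(1 + \<bar>x $ i\<bar>) powr (1 + \<delta>) \<le> (c * (1 + N x)) powr (1 + \<delta>)"
          using \<delta> by (intro powr_mono2) auto
        also have "\<dots> = c powr (1 + \<delta>) * (1 + N x) powr (1 + \<delta>)"
          by (rule powr_mult)
        finally have "\<bar>x $ i - g i\<bar> \<le> c powr (1 + \<delta>) * (1 + N x) powr (1 + \<delta>) / (\<delta> * k)"
          using g(2)[of i] \<delta> by (meson divide_right_mono mult_nonneg_nonneg of_nat_0_le_iff order_trans less_imp_le)
        also have "\<dots> \<le> c powr (1 + \<delta>) * (1 + N x) powr (1 + \<delta>) / (\<delta> * (y / 4))"
          using yk y(1) \<delta> k(1) by (intro divide_left_mono) auto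
        finally show ?thesis by (simp add: field_simps)
      qed
      have "ndist N x A \<le> N (x - vec_lambda g)"
        using Aq gA by (intro ndist_le) (auto simp: quantizers_def)
      also have "\<dots> \<le> K * norm (x - vec_lambda g)" by (rule mK(4))
      also have "\<dots> \<le> K * (\<Sum>i\<in>UNIV. \<bar>x $ i - g i\<bar>)"
        using norm_le_l1_cart[of "x - vec_lambda g"] mK(2) by (intro mult_left_mono) auto
      also have "\<dots> \<le> K * (\<Sum>i\<in>(UNIV :: 'd set). (4 / \<delta>) * c powr (1 + \<delta>) * ((1 + N x) powr (1 + \<delta>) / y))"
        using mK(2) coord by (intro mult_left_mono sum_mono) auto
      also have "\<dots> = C * n powr (- (1 / d)) * (1 + N x) powr (1 + \<delta>)"
        by (simp add: C_def y_def powr_minus d_def field_simps)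
      finally show ?thesis .
    qed
    then show "\<exists>A\<in>quantizers n. \<forall>x. ndist N x A \<le> C * n powr (- (1 / CARD('d))) * (1 + N x) powr (1 + \<delta>)"
      using Aq unfolding d_def by blast
  qed
qed

text \<open>The upper bound of Pierce and Zador: with \<open>\<delta> = \<eta> / r\<close>, the \<open>r\<close>-th power of the weight in the previous
  lemma is the integrable function \<open>(1 + N x) powr (r + \<eta>)\<close>.\<close>

lemma optimal_distortion_rate:
  fixes N :: "real ^ 'd \<Rightarrow> real"
  assumes N: "is_norm N" and r: "0 < r" and \<eta>: "0 < \<eta>"
    and P: "prob_space P" and sP: "sets P = sets borel"
    and mom: "(\<integral>\<^sup>+ x. ennreal (N x powr (r + \<eta>)) \<partial>P) < \<infinity>"
    and opt: "optimal_quantizers N r P \<alpha>"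
  obtains C where "0 < C"
    "\<And>n. 1 \<le> n \<Longrightarrow> distortion N r P (\<alpha> n) \<le> ennreal (C * n powr (- (r / CARD('d))))"
proof -
  interpret P: prob_space P by (rule P)
  note [measurable_cong] = sP
  note [measurable] = is_norm_borel_measurable[OF N]
  define \<delta> where "\<delta> = \<eta> / r"
  have \<delta>: "0 < \<delta>" "(1 + \<delta>) * r = r + \<eta>" using r \<eta> by (auto simp: \<delta>_def field_simps)
  obtain C where C: "0 < C"
    "\<And>n. 1 \<le> n \<Longrightarrow> \<exists>A\<in>quantizers n. \<forall>x. ndist N x A \<le> C * n powr (- (1 / CARD('d))) * (1 + N x) powr (1 + \<delta>)"
    using quantizer_polynomial_spacing[OF N \<delta>(1)] by metis
  let ?I = "\<integral>\<^sup>+ x. ennreal ((1 + N x) powr (r + \<eta>)) \<partial>P"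
  have "?I \<le> (\<integral>\<^sup>+ x. ennreal (2 powr (r + \<eta>)) * (1 + ennreal (N x powr (r + \<eta>))) \<partial>P)"
  proof (rule nn_integral_mono)
    fix x
    have "(1 + N x) powr (r + \<eta>) \<le> (2 * max 1 (N x)) powr (r + \<eta>)"
      using is_norm_nonneg[OF N, of x] r \<eta> by (intro powr_mono2) auto
    also have "\<dots> = 2 powr (r + \<eta>) * (max 1 (N x)) powr (r + \<eta>)"
      by (rule powr_mult)
    also have "\<dots> \<le> 2 powr (r + \<eta>) * (1 + N x powr (r + \<eta>))"
      by (intro mult_left_mono) (auto simp: max_def)
    finally have "ennreal ((1 + N x) powr (r + \<eta>)) \<le> ennreal (2 powr (r + \<eta>) * (1 + N x powr (r + \<eta>)))"
      by (rule ennreal_leI)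
    then show "ennreal ((1 + N x) powr (r + \<eta>)) \<le> ennreal (2 powr (r + \<eta>)) * (1 + ennreal (N x powr (r + \<eta>)))"
      by (simp add: ennreal_mult)
  qed
  also have "\<dots> < \<infinity>"
    using mom by (simp add: nn_integral_cmult nn_integral_add P.emeasure_space_1 ennreal_mult_less_top)
  finally have I: "?I < \<infinity>" .
  define J where "J = enn2real ?I"
  have IJ: "?I = ennreal J" "0 \<le> J" using I by (auto simp: J_def)
  show ?thesis
  proof
    show "0 < C powr r * (J + 1)" using C(1) IJ(2) by simp
    fix n :: nat assume n: "1 \<le> n"
    obtain A where A: "A \<in> quantizers n"
      "\<And>x. ndist N x A \<le> C * n powr (- (1 / CARD('d))) * (1 + N x) powr (1 + \<delta>)"
      using C(2)[OF n] by blast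
    have "distortion N r P (\<alpha> n) \<le> distortion N r P A"
      using opt n A(1) by (auto simp: optimal_quantizers_def intro: INF_lower)
    also have "\<dots> \<le> (\<integral>\<^sup>+ x. ennreal (C powr r * n powr (- (r / CARD('d)))) * ennreal ((1 + N x) powr (r + \<eta>)) \<partial>P)"
      unfolding distortion_def
    proof (rule nn_integral_mono)
      fix x
      have "ndist N x A powr r \<le> (C * n powr (- (1 / CARD('d))) * (1 + N x) powr (1 + \<delta>)) powr r"
        using A r ndist_nonneg[OF N] by (intro powr_mono2) (auto simp: quantizers_def)
      also have "\<dots> = C powr r * n powr (- (r / CARD('d))) * (1 + N x) powr (r + \<eta>)"
        using C(1) n \<delta>(2) by (simp add: powr_mult powr_powr)
      finally show "ennreal (ndist N x A powr r) \<le> ennreal (C powr r * n powr (- (r / CARD('d)))) * ennreal ((1 + N x) powr (r + \<eta>))"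
        by (simp add: ennreal_mult[symmetric] ennreal_leI)
    qed
    also have "\<dots> = ennreal (C powr r * n powr (- (r / CARD('d)))) * ?I"
      by (simp add: nn_integral_cmult)
    also have "\<dots> = ennreal (C powr r * n powr (- (r / CARD('d))) * J)"
      using IJ by (simp add: ennreal_mult)
    also have "\<dots> \<le> ennreal (C powr r * (J + 1) * n powr (- (r / CARD('d))))"
      by (intro ennreal_leI) (simp add: algebra_simps)
    finally show "distortion N r P (\<alpha> n) \<le> ennreal (C powr r * (J + 1) * n powr (- (r / CARD('d))))" .
  qed
qed

section \<open>The cost of removing a point and the gain of adding one\<close>

text \<open>Up to the factor \<open>2 powr r\<close>, this bounds the increase of the distortion when \<open>a\<close> is removed from \<open>A\<close>:
  the points which \<open>\<pi>\<close> sends to \<open>a\<close> are moved to the neighbour of \<open>a\<close> in \<open>A - {a}\<close>. The cells are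
  fibres of a projection \<open>\<pi>\<close>, and not the sets \<open>{y. N (y - a) = ndist N y A}\<close>, because the fibres are
  disjoint.\<close>

definition removal_cost ::
  "(real ^ 'd \<Rightarrow> real) \<Rightarrow> real \<Rightarrow> (real ^ 'd) measure \<Rightarrow> (real ^ 'd) set \<Rightarrow> (real ^ 'd \<Rightarrow> real ^ 'd)
     \<Rightarrow> real ^ 'd \<Rightarrow> ennreal" where
  "removal_cost N r P A \<pi> a =
     (\<integral>\<^sup>+ y. ennreal (ndist N y A powr r + ndist N a (A - {a}) powr r) * indicator (\<pi> -` {a}) y \<partial>P)"

lemma powr_add_le:
  fixes s t r :: real
  assumes "0 \<le> s" "0 \<le> t" "0 < r"
  shows "(s + t) powr r \<le> 2 powr r * (s powr r + t powr r)"
proof -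
  have "(s + t) powr r \<le> (2 * max s t) powr r"
    using assms by (intro powr_mono2) auto
  also have "\<dots> = 2 powr r * max s t powr r"
    by (rule powr_mult)
  also have "\<dots> \<le> 2 powr r * (s powr r + t powr r)"
    by (intro mult_left_mono) (auto simp: max_def)
  finally show ?thesis .
qed

text \<open>Replacing \<open>a\<close> by \<open>x\<close> cannot improve on an optimal set. Near \<open>x\<close>, in the ball of radius \<open>b\<close> times the
  distance from \<open>x\<close> to \<open>A\<close>, the new point brings a gain, as \<open>b < 1 - b\<close>: the distance was at least
  \<open>(1 - b)\<close> times that of \<open>x\<close> and becomes at most \<open>b\<close> times it. Outside of that ball only the points in
  the cell of \<open>a\<close> may lose.\<close>

lemma exchange_inequality:
  fixes N :: "real ^ 'd \<Rightarrow> real"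
  assumes N: "is_norm N" and r: "0 < r" and b: "0 < b" "b < 1 / 2"
    and sP: "sets P = sets borel"
    and A: "finite A" "a \<in> A" "A - {a} \<noteq> {}"
    and \<pi>: "nearest_neighbour_projection N A \<pi>"
    and fin: "distortion N r P A < \<infinity>"
    and opt: "distortion N r P A \<le> distortion N r P (insert x (A - {a}))"
  shows "ennreal (((1 - b) powr r - b powr r) * ndist N x A powr r)
           * emeasure P (nball N x (b * ndist N x A))
         \<le> ennreal (2 powr r) * removal_cost N r P A \<pi> a"
proof -
  note [measurable_cong] = sP
  note [measurable] = ndist_borel_measurable[OF N] nball_borel[OF N]
  have [measurable]: "\<pi> \<in> borel_measurable borel"
    using \<pi> by (simp add: nearest_neighbour_projection_def)
  have \<pi>A: "\<pi> y \<in> A" "N (y - \<pi> y) = ndist N y A" for y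
    using \<pi> by (auto simp: nearest_neighbour_projection_def)
  define \<kappa> where "\<kappa> = (1 - b) powr r - b powr r"
  have \<kappa>: "0 < \<kappa>" using b r by (simp add: \<kappa>_def powr_less_mono2)
  define D where "D = ndist N x A"
  define A' where "A' = insert x (A - {a})"
  define V where "V = \<pi> -` {a}"
  define B where "B = nball N x (b * D)"
  define \<delta> where "\<delta> = ndist N a (A - {a})"
  have A': "finite A'" "A' \<noteq> {}" using A by (auto simp: A'_def)
  have Ane: "A \<noteq> {}" using A by auto
  have nn: "0 \<le> ndist N y A" "0 \<le> ndist N y A'" "0 \<le> \<delta>" for y
    using ndist_nonneg[OF N] A A' Ane by (auto simp: \<delta>_def)
  have D: "0 \<le> D" using nn by (simp add: D_def)
  have [measurable]: "B \<in> sets borel" "V \<in> sets borel"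
    using measurable_sets[of \<pi> borel borel "{a}"] by (auto simp: B_def V_def)
  have pointwise: "ndist N y A' powr r + \<kappa> * D powr r * indicator B y
      \<le> ndist N y A powr r + 2 powr r * ((ndist N y A powr r + \<delta> powr r) * indicator V y)" for y
  proof (cases "y \<in> B")
    case True
    then have y: "N (y - x) \<le> b * D" by (simp add: B_def nball_def)
    have "ndist N y A' \<le> N (y - x)" using A' by (intro ndist_le) (auto simp: A'_def)
    then have "ndist N y A' \<le> b * D" using y by simp
    then have 1: "ndist N y A' powr r \<le> b powr r * D powr r"
      using nn r D b by (simp add: powr_mono2 flip: powr_mult)
    have "D \<le> N (x - y) + ndist N y A"
      unfolding D_def by (rule ndist_triangle[OF N A(1) Ane])
    then have "(1 - b) * D \<le> ndist N y A"
      using y is_norm_minus_commute[OF N, of x y] by (simp add: algebra_simps)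
    then have 2: "(1 - b) powr r * D powr r \<le> ndist N y A powr r"
      using nn r D b by (simp add: powr_mono2 flip: powr_mult)
    have "0 \<le> 2 powr r * ((ndist N y A powr r + \<delta> powr r) * indicator V y)" by simp
    moreover have "\<kappa> * D powr r * indicator B y = (1 - b) powr r * D powr r - b powr r * D powr r"
      using True by (simp add: \<kappa>_def left_diff_distrib)
    ultimately show ?thesis using 1 2 by linarith
  next
    case False
    show ?thesis
    proof (cases "\<pi> y = a")
      case True
      obtain c where c: "c \<in> A - {a}" "\<delta> = N (a - c)"
        using ndist_attained[of "A - {a}" N a] A by (auto simp: \<delta>_def)
      have "ndist N y A' \<le> N (y - c)" using A' c by (intro ndist_le) (auto simp: A'_def)
      also have "\<dots> \<le> ndist N y A + \<delta>"
        using is_norm_triangle_diff[OF N, of y c a] \<pi>A(2)[of y] True c(2) by simp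
      finally have "ndist N y A' powr r \<le> (ndist N y A + \<delta>) powr r"
        using nn r by (intro powr_mono2) auto
      also have "\<dots> \<le> 2 powr r * (ndist N y A powr r + \<delta> powr r)"
        using nn r by (intro powr_add_le) auto
      also have "\<dots> \<le> ndist N y A powr r + \<dots>" by simp
      finally show ?thesis using False True by (simp add: V_def)
    next
      case other: False
      have "ndist N y A' \<le> N (y - \<pi> y)"
        using A' other \<pi>A(1)[of y] by (intro ndist_le) (auto simp: A'_def)
      then have "ndist N y A' powr r \<le> ndist N y A powr r"
        using nn r \<pi>A(2)[of y] by (intro powr_mono2) auto
      then show ?thesis using False other by (simp add: V_def)
    qed
  qed
  have "distortion N r P A' + ennreal (\<kappa> * D powr r) * emeasure P B
      = (\<integral>\<^sup>+ y. ennreal (ndist N y A' powr r) + ennreal (\<kappa> * D powr r) * indicator B y \<partial>P)"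
    using A'(1) by (simp add: distortion_def nn_integral_add nn_integral_cmult sP)
  also have "\<dots> = (\<integral>\<^sup>+ y. ennreal (ndist N y A' powr r + \<kappa> * D powr r * indicator B y) \<partial>P)"
    using \<kappa> by (intro nn_integral_cong) (auto simp: indicator_def)
  also have "\<dots> \<le> (\<integral>\<^sup>+ y. ennreal (ndist N y A powr r + 2 powr r * ((ndist N y A powr r + \<delta> powr r) * indicator V y)) \<partial>P)"
    by (intro nn_integral_mono ennreal_leI pointwise)
  also have "\<dots> = (\<integral>\<^sup>+ y. ennreal (ndist N y A powr r)
      + ennreal (2 powr r) * (ennreal (ndist N y A powr r + \<delta> powr r) * indicator V y) \<partial>P)"
    by (intro nn_integral_cong) (auto simp: indicator_def ennreal_mult[symmetric] simp flip: ennreal_plus)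
  also have "\<dots> = distortion N r P A + ennreal (2 powr r) * removal_cost N r P A \<pi> a"
    using A(1) by (simp add: distortion_def removal_cost_def nn_integral_add nn_integral_cmult V_def[symmetric] \<delta>_def[symmetric])
  finally have main: "distortion N r P A' + ennreal (\<kappa> * D powr r) * emeasure P B
      \<le> distortion N r P A + ennreal (2 powr r) * removal_cost N r P A \<pi> a" .
  have "distortion N r P A + ennreal (\<kappa> * D powr r) * emeasure P B
      \<le> distortion N r P A' + ennreal (\<kappa> * D powr r) * emeasure P B"
    using opt unfolding A'_def by (rule add_right_mono)
  also note main
  finally have "ennreal (\<kappa> * D powr r) * emeasure P B \<le> ennreal (2 powr r) * removal_cost N r P A \<pi> a"
    using fin by (subst (asm) ennreal_add_left_cancel_le) auto
  then show ?thesis by (simp add: \<kappa>_def D_def B_def)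
qed

text \<open>The cells are disjoint, so the removal costs of well surrounded points add up to no more than the
  distortion plus \<open>\<rho> powr r\<close>; among many such points one must be cheap to remove.\<close>

lemma sum_removal_cost_le:
  fixes N :: "real ^ 'd \<Rightarrow> real"
  assumes N: "is_norm N" and r: "0 < r"
    and P: "prob_space P" and sP: "sets P = sets borel"
    and A: "finite A" and \<pi>: "nearest_neighbour_projection N A \<pi>"
    and T: "T \<subseteq> A" "\<And>a. a \<in> T \<Longrightarrow> A - {a} \<noteq> {} \<and> ndist N a (A - {a}) \<le> \<rho>"
  shows "(\<Sum>a\<in>T. removal_cost N r P A \<pi> a) \<le> distortion N r P A + ennreal (\<rho> powr r)"
proof -
  interpret P: prob_space P by (rule P)
  note [measurable_cong] = sP
  note [measurable] = ndist_borel_measurable[OF N]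
  have [measurable]: "\<pi> \<in> borel_measurable borel"
    using \<pi> by (simp add: nearest_neighbour_projection_def)
  have [measurable]: "\<pi> -` {a} \<in> sets borel" for a
    using measurable_sets[of \<pi> borel borel "{a}"] by simp
  have finT: "finite T" using T(1) A finite_subset by blast
  have "(\<Sum>a\<in>T. removal_cost N r P A \<pi> a)
      \<le> (\<Sum>a\<in>T. \<integral>\<^sup>+ y. ennreal (ndist N y A powr r + \<rho> powr r) * indicator (\<pi> -` {a}) y \<partial>P)"
    unfolding removal_cost_def using T(2) r A N
    by (intro sum_mono nn_integral_mono mult_right_mono ennreal_leI add_left_mono powr_mono2 ndist_nonneg) auto
  also have "\<dots> = (\<integral>\<^sup>+ y. (\<Sum>a\<in>T. ennreal (ndist N y A powr r + \<rho> powr r) * indicator (\<pi> -` {a}) y) \<partial>P)"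
    using A by (intro nn_integral_sum[symmetric]) simp
  also have "\<dots> \<le> (\<integral>\<^sup>+ y. ennreal (ndist N y A powr r + \<rho> powr r) \<partial>P)"
  proof (rule nn_integral_mono)
    fix y
    have "(\<Sum>a\<in>T. indicator (\<pi> -` {a}) y :: ennreal) \<le> 1"
      using finT card_mono[of "{\<pi> y}" "T \<inter> {\<pi> y}"] by (simp add: indicator_def)
    then show "(\<Sum>a\<in>T. ennreal (ndist N y A powr r + \<rho> powr r) * indicator (\<pi> -` {a}) y)
        \<le> ennreal (ndist N y A powr r + \<rho> powr r)"
      unfolding sum_distrib_left[symmetric] using mult_left_mono by fastforce
  qed
  also have "\<dots> = distortion N r P A + ennreal (\<rho> powr r)"
    using A by (simp add: distortion_def nn_integral_add P.emeasure_space_1)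
  finally show ?thesis .
qed

section \<open>Optimal quantizers contain cheap points\<close>

text \<open>The balls of radius \<open>\<rho> / 2\<close> around the points are disjoint and fit in a ball of radius \<open>R + \<rho> / 2\<close>.\<close>

lemma card_separated_le:
  fixes N :: "'a::euclidean_space \<Rightarrow> real"
  assumes N: "is_norm N" and T: "finite T" "T \<subseteq> nball N 0 R" and "0 \<le> R" and \<rho>: "0 < \<rho>"
    and sep: "\<And>x y. x \<in> T \<Longrightarrow> y \<in> T \<Longrightarrow> x \<noteq> y \<Longrightarrow> \<rho> < N (x - y)"
  shows "card T * (\<rho> / 2) ^ DIM('a) \<le> (R + \<rho> / 2) ^ DIM('a)"
proof -
  define v where "v = measure lborel (nball N (0::'a) 1)"
  have v: "0 < v" unfolding v_def by (rule measure_nball_pos[OF N])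
  note [measurable] = nball_borel[OF N]
  have disj: "disjoint_family_on (\<lambda>a. nball N a (\<rho> / 2)) T"
    unfolding disjoint_family_on_def
  proof (intro ballI impI equals0I)
    fix x y z assume xy: "x \<in> T" "y \<in> T" "x \<noteq> y" and z: "z \<in> nball N x (\<rho> / 2) \<inter> nball N y (\<rho> / 2)"
    have "N (x - y) \<le> N (x - z) + N (z - y)" by (rule is_norm_triangle_diff[OF N])
    also have "\<dots> \<le> \<rho>" using z is_norm_minus_commute[OF N, of x z] by (simp add: nball_def)
    finally show False using sep[OF xy] by simp
  qed
  have "ennreal (card T * (v * (\<rho> / 2) ^ DIM('a))) = (\<Sum>a\<in>T. emeasure lborel (nball N a (\<rho> / 2)))"
    using \<rho> v by (simp add: emeasure_nball[OF N] v_def[symmetric] ennreal_mult ennreal_of_nat_eq_real_of_nat)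
  also have "\<dots> = emeasure lborel (\<Union>a\<in>T. nball N a (\<rho> / 2))"
    using T(1) disj by (intro sum_emeasure) auto
  also have "\<dots> \<le> emeasure lborel (nball N 0 (R + \<rho> / 2))"
  proof (rule emeasure_mono)
    show "(\<Union>a\<in>T. nball N a (\<rho> / 2)) \<subseteq> nball N 0 (R + \<rho> / 2)"
    proof
      fix y assume "y \<in> (\<Union>a\<in>T. nball N a (\<rho> / 2))"
      then obtain a where "N (y - a) \<le> \<rho> / 2" "N a \<le> R" using T(2) by (auto simp: nball_def)
      then show "y \<in> nball N 0 (R + \<rho> / 2)"
        using is_norm_triangle[OF N, of "y - a" a] by (simp add: nball_def)
    qed
  qed simp
  also have "\<dots> = ennreal (v * (R + \<rho> / 2) ^ DIM('a))"
    using \<rho> \<open>0 \<le> R\<close> by (simp add: emeasure_nball[OF N] v_def)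
  finally have "card T * (v * (\<rho> / 2) ^ DIM('a)) \<le> v * (R + \<rho> / 2) ^ DIM('a)"
    using \<rho> v \<open>0 \<le> R\<close> by (subst (asm) ennreal_le_iff) auto
  then have "v * (card T * (\<rho> / 2) ^ DIM('a)) \<le> v * (R + \<rho> / 2) ^ DIM('a)" by (simp add: mult_ac)
  then show ?thesis using v by simp
qed

lemma powr_inverse_dimension:
  assumes "1 \<le> n" "0 < \<tau>" "0 < d"
  shows "(\<tau> * real n powr (- (1 / real d))) ^ d = \<tau> ^ d / n"
    and "(\<tau> * real n powr (- (1 / real d))) powr r = \<tau> powr r * n powr (- (r / d))"
proof -
  have "(real n powr (- (1 / real d))) ^ d = real n powr (- 1)"
    using assms by (simp add: powr_realpow[symmetric] powr_powr)
  then show "(\<tau> * real n powr (- (1 / real d))) ^ d = \<tau> ^ d / n"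
    using assms by (simp add: power_mult_distrib powr_minus divide_inverse)
  show "(\<tau> * real n powr (- (1 / real d))) powr r = \<tau> powr r * n powr (- (r / d))"
    by (simp add: powr_mult powr_powr)
qed

lemma eventually_powr_inverse_dimension_le:
  assumes "0 < \<tau>" "0 < d" "0 < e"
  shows "\<forall>\<^sub>F n in sequentially. \<tau> * real n powr (- (1 / real d)) \<le> e"
proof -
  have "((\<lambda>n. \<tau> * real n powr (- (1 / real d))) \<longlongrightarrow> \<tau> * 0) sequentially"
    using assms by (intro tendsto_mult tendsto_const tendsto_neg_powr filterlim_real_sequentially) auto
  then have "\<forall>\<^sub>F n in sequentially. \<tau> * real n powr (- (1 / real d)) < e"
    using assms by (intro order_tendstoD(2)) auto
  then show ?thesis by eventually_elim simp
qed

text \<open>On a bounded set \<open>K\<close> of positive mass where \<open>f\<close> is bounded, the mass within \<open>\<rho>\<close> of \<open>m\<close> points is at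
  most of order \<open>m \<rho> ^ d\<close>. At the scale \<open>\<rho> = \<tau> n powr (- 1 / d)\<close> with \<open>\<tau>\<close> large, the bound on the
  distortion forces half of the mass of \<open>K\<close> to be within \<open>\<rho>\<close> of \<open>\<alpha> n\<close>, so a number of points of order
  \<open>n\<close> lies near \<open>K\<close>: optimal quantizers cannot send all but a vanishing proportion of their points
  away.\<close>

lemma card_points_in_bounded_region:
  fixes N :: "real ^ 'd \<Rightarrow> real" and f :: "real ^ 'd \<Rightarrow> real" and \<alpha> :: "nat \<Rightarrow> (real ^ 'd) set"
  assumes N: "is_norm N" and r: "0 < r"
    and f [measurable]: "f \<in> borel_measurable borel" and f0: "\<And>x. 0 \<le> f x"
    and P: "prob_space P" "P = density lborel (\<lambda>x. ennreal (f x))"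
    and \<alpha>: "\<And>n. 1 \<le> n \<Longrightarrow> finite (\<alpha> n) \<and> \<alpha> n \<noteq> {}"
    and C: "0 < C" "\<And>n. 1 \<le> n \<Longrightarrow> distortion N r P (\<alpha> n) \<le> ennreal (C * n powr (- (r / CARD('d))))"
  obtains c R where "0 < c" "0 < R"
    "\<forall>\<^sub>F n in sequentially. c * real n \<le> card (\<alpha> n \<inter> nball N 0 R)"
proof -
  interpret P: prob_space P by (rule P)
  have sP [simp, measurable_cong]: "sets P = sets borel" by (simp add: P(2))
  note [measurable] = ndist_borel_measurable[OF N] nball_borel[OF N] is_norm_borel_measurable[OF N]
  define d where "d = CARD('d)"
  have d: "0 < d" by (simp add: d_def)
  define v where "v = measure lborel (nball N (0::real ^ 'd) 1)"
  have v: "0 < v" unfolding v_def by (rule measure_nball_pos[OF N])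
  define K where "K k = {x. N x \<le> real k \<and> f x \<le> real k}" for k
  have K [measurable]: "K k \<in> sets borel" for k unfolding K_def by measurable
  have "\<exists>k. emeasure P (K k) \<noteq> 0"
  proof (rule ccontr)
    assume "\<nexists>k. emeasure P (K k) \<noteq> 0"
    then have "emeasure P (\<Union>k. K k) = 0"
      by (intro emeasure_UN_eq_0) auto
    moreover have "(\<Union>k. K k) = space P"
    proof -
      have "\<exists>k. x \<in> K k" for x
      proof -
        obtain k :: nat where "max (N x) (f x) \<le> k" using real_arch_simple by blast
        then show ?thesis by (auto simp: K_def)
      qed
      then show ?thesis by (auto simp: P(2))
    qed
    ultimately show False using P.emeasure_space_1 by simp
  qed
  then obtain k where "emeasure P (K k) \<noteq> 0" by blast
  then have pk: "0 < measure P (K k)" by (simp add: P.emeasure_eq_measure zero_less_measure_iff)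
  \<comment> \<open>a bound for the density on \<open>K k\<close>, and a radius containing every point at distance at most \<open>1\<close> from \<open>K k\<close>\<close>
  define L where "L = real k + 1"
  have L: "0 < L" "\<And>x. x \<in> K k \<Longrightarrow> f x \<le> L" "\<And>x. x \<in> K k \<Longrightarrow> N x \<le> L - 1"
    by (auto simp: L_def K_def)
  define p where "p = measure P (K k)"
  have p: "0 < p" using pk by (simp add: p_def)
  \<comment> \<open>chosen so that mass \<open>p / 2\<close> at distance \<open>\<rho>\<close> already uses up the distortion \<open>C n powr (- r / d)\<close>\<close>
  define \<tau> where "\<tau> = (2 * C / p) powr (1 / r)"
  have \<tau>: "0 < \<tau>" "\<tau> powr r = 2 * C / p"
    using C(1) p r by (auto simp: \<tau>_def powr_powr)
  define c where "c = p / (2 * L * v * \<tau> ^ d)"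
  show ?thesis
  proof
    show "0 < c" using p L v \<tau> by (simp add: c_def)
    show "0 < L" by (rule L)
    have "\<forall>\<^sub>F n in sequentially. \<tau> * real n powr (- (1 / real d)) \<le> 1"
      using \<tau> d by (intro eventually_powr_inverse_dimension_le) auto
    then show "\<forall>\<^sub>F n in sequentially. c * real n \<le> card (\<alpha> n \<inter> nball N 0 L)"
      using eventually_ge_at_top[of 1]
    proof eventually_elim
      fix n :: nat assume small: "\<tau> * real n powr (- (1 / real d)) \<le> 1" and n: "1 \<le> n"
      define \<rho> where "\<rho> = \<tau> * real n powr (- (1 / real d))"
      have \<rho>: "0 < \<rho>" "\<rho> \<le> 1" "\<rho> ^ d = \<tau> ^ d / n" "\<rho> powr r = (2 * C / p) * n powr (- (r / d))"
        using small n \<tau> powr_inverse_dimension[OF n \<tau>(1) d] by (auto simp: \<rho>_def)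
      let ?A = "\<alpha> n" and ?T = "\<alpha> n \<inter> nball N 0 L"
      have A: "finite ?A" "?A \<noteq> {}" using \<alpha>[OF n] by auto
      let ?far = "K k \<inter> {y. \<rho> < ndist N y ?A}"
      have far [measurable]: "?far \<in> sets borel" using A(1) by measurable
      have "ennreal (\<rho> powr r * measure P ?far) = (\<integral>\<^sup>+ y. ennreal (\<rho> powr r) * indicator ?far y \<partial>P)"
        by (simp add: nn_integral_cmult P.emeasure_eq_measure ennreal_mult)
      also have "\<dots> \<le> distortion N r P ?A"
        unfolding distortion_def using \<rho>(1) r
        by (intro nn_integral_mono) (auto simp: indicator_def intro!: ennreal_leI powr_mono2)
      also have "\<dots> \<le> ennreal (C * n powr (- (r / d)))"
        using C(2)[OF n] by (simp add: d_def)
      finally have "\<rho> powr r * measure P ?far \<le> C * n powr (- (r / d))"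
        using C(1) by (subst (asm) ennreal_le_iff) auto
      then have "(n powr (- (r / d)) * C) * (2 * measure P ?far / p) \<le> (n powr (- (r / d)) * C) * 1"
        by (simp add: \<rho>(4) field_simps)
      then have far_le: "measure P ?far \<le> p / 2"
        using C(1) n p by (subst (asm) mult_le_cancel_left_pos) (auto simp: field_simps)
      have near: "K k - ?far \<subseteq> (\<Union>a\<in>?T. nball N a \<rho> \<inter> K k)"
      proof
        fix y assume y: "y \<in> K k - ?far"
        obtain a where a: "a \<in> ?A" "ndist N y ?A = N (y - a)"
          using ndist_attained[OF A] by metis
        have ya: "N (y - a) \<le> \<rho>" using y a(2) by auto
        have "N a \<le> N (a - y) + N y" using is_norm_triangle[OF N, of "a - y" y] by simp
        also have "\<dots> \<le> L" using ya \<rho>(2) L(3)[of y] y is_norm_minus_commute[OF N, of a y] by auto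
        finally show "y \<in> (\<Union>a\<in>?T. nball N a \<rho> \<inter> K k)"
          using a(1) ya y by (auto simp: nball_def)
      qed
      have ball: "measure P (nball N a \<rho> \<inter> K k) \<le> L * (v * \<rho> ^ d)" for a
      proof -
        have "emeasure P (nball N a \<rho> \<inter> K k) \<le> (\<integral>\<^sup>+ y. ennreal L * indicator (nball N a \<rho>) y \<partial>lborel)"
          unfolding P(2) using L(2)
          by (subst emeasure_density) (auto simp: indicator_def intro!: nn_integral_mono ennreal_leI)
        also have "\<dots> = ennreal (L * (v * \<rho> ^ d))"
          using \<rho>(1) L(1) v
          by (simp add: nn_integral_cmult emeasure_nball[OF N] ennreal_mult v_def[symmetric] d_def)
        finally show ?thesis
          using L(1) v \<rho>(1) by (simp add: P.emeasure_eq_measure)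
      qed
      have "p = measure P ?far + measure P (K k - ?far)"
        unfolding p_def by (subst P.finite_measure_Union[symmetric]) (auto intro!: arg_cong[where f = "measure P"])
      also have "measure P (K k - ?far) \<le> measure P (\<Union>a\<in>?T. nball N a \<rho> \<inter> K k)"
        using near A(1) by (intro P.finite_measure_mono sets.finite_UN) auto
      also have "\<dots> \<le> (\<Sum>a\<in>?T. measure P (nball N a \<rho> \<inter> K k))"
        using A(1) by (intro measure_UNION_le) auto
      also have "\<dots> \<le> card ?T * (L * (v * \<rho> ^ d))"
        using sum_mono[of ?T "\<lambda>a. measure P (nball N a \<rho> \<inter> K k)" "\<lambda>_. L * (v * \<rho> ^ d)"] ball by simp
      finally have "p / 2 \<le> card ?T * (L * (v * \<rho> ^ d))"
        using far_le by linarith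
      then show "c * real n \<le> card ?T"
        unfolding \<rho>(3) using n L(1) v \<tau>(1) by (simp add: c_def field_simps)
    qed
  qed
qed

lemma ennreal_mult_le_imp_le_divide:
  assumes "ennreal u * x \<le> ennreal q" "0 < u"
  shows "x \<le> ennreal (q / u)"
proof (cases x)
  case (real t)
  show ?thesis
  proof (cases "0 \<le> q")
    case True
    have "u * t \<le> q"
      using assms real True by (simp add: ennreal_mult[symmetric] ennreal_le_iff)
    then show ?thesis using real assms(2) by (simp add: pos_le_divide_eq mult.commute ennreal_leI)
  next
    case False
    then have "ennreal u * x = 0" using assms(1) by (simp add: ennreal_neg)
    then show ?thesis using assms(2) by (simp add: ennreal_eq_0_iff)
  qed
next
  case top
  then show ?thesis using assms by (simp add: ennreal_mult_top top_unique)
qed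

text \<open>Of the at least \<open>c n\<close> points in a bounded region, at most half can be farther than
  \<open>\<sigma> n powr (- 1 / d)\<close> from all others, by the packing bound. Averaging the removal costs over the
  remaining points, which sum to order \<open>n powr (- r / d)\<close>, gives the additional factor \<open>1 / n\<close>.\<close>

lemma exists_cheap_point:
  fixes N :: "real ^ 'd \<Rightarrow> real" and \<alpha> :: "nat \<Rightarrow> (real ^ 'd) set"
  assumes N: "is_norm N" and r: "0 < r"
    and P: "prob_space P" and sP: "sets P = sets borel"
    and \<alpha>: "\<And>n. 1 \<le> n \<Longrightarrow> finite (\<alpha> n)"
    and C: "0 < C" "\<And>n. 1 \<le> n \<Longrightarrow> distortion N r P (\<alpha> n) \<le> ennreal (C * n powr (- (r / CARD('d))))"
    and c: "0 < c" "0 < R" "\<forall>\<^sub>F n in sequentially. c * real n \<le> card (\<alpha> n \<inter> nball N 0 R)"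
  obtains C' where "0 < C'"
    "\<forall>\<^sub>F n in sequentially. \<forall>\<pi>. nearest_neighbour_projection N (\<alpha> n) \<pi> \<longrightarrow>
       (\<exists>a\<in>\<alpha> n. \<alpha> n - {a} \<noteq> {} \<and>
          removal_cost N r P (\<alpha> n) \<pi> a \<le> ennreal (C' * n powr (- (1 + r / CARD('d)))))"
proof -
  define d where "d = CARD('d)"
  have d: "0 < d" by (simp add: d_def)
  \<comment> \<open>the packing bound for points that are \<open>\<rho>\<close>-separated then reads \<open>card S \<le> c n / 2\<close>\<close>
  define \<sigma> where "\<sigma> = 2 * (R + 1) * (2 / c) powr (1 / d)"
  have \<sigma>: "0 < \<sigma>" "\<sigma> ^ d = (2 * (R + 1)) ^ d * (2 / c)"
    using c d by (auto simp: \<sigma>_def power_mult_distrib powr_realpow[symmetric] powr_powr)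
  define C' where "C' = 2 * (C + \<sigma> powr r) / c"
  show ?thesis
  proof
    show "0 < C'" using C(1) c(1) by (simp add: C'_def add_pos_nonneg)
    have "\<forall>\<^sub>F n in sequentially. \<sigma> * real n powr (- (1 / real d)) \<le> 2"
      using \<sigma> d by (intro eventually_powr_inverse_dimension_le) auto
    moreover have "\<forall>\<^sub>F n in sequentially. 2 / c \<le> real n"
      using filterlim_real_sequentially by (simp add: filterlim_at_top)
    ultimately show "\<forall>\<^sub>F n in sequentially. \<forall>\<pi>. nearest_neighbour_projection N (\<alpha> n) \<pi> \<longrightarrow>
       (\<exists>a\<in>\<alpha> n. \<alpha> n - {a} \<noteq> {} \<and>
          removal_cost N r P (\<alpha> n) \<pi> a \<le> ennreal (C' * n powr (- (1 + r / CARD('d)))))"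
      using c(3) eventually_ge_at_top[of 1]
    proof (eventually_elim, intro allI impI)
      fix n \<pi>
      assume small: "\<sigma> * real n powr (- (1 / real d)) \<le> 2" and large: "2 / c \<le> real n"
        and card: "c * real n \<le> card (\<alpha> n \<inter> nball N 0 R)" and n: "1 \<le> n"
        and \<pi>: "nearest_neighbour_projection N (\<alpha> n) \<pi>"
      define \<rho> where "\<rho> = \<sigma> * real n powr (- (1 / real d))"
      have \<rho>: "0 < \<rho>" "\<rho> \<le> 2" "\<rho> ^ d = \<sigma> ^ d / n" "\<rho> powr r = \<sigma> powr r * n powr (- (r / d))"
        using small n \<sigma> powr_inverse_dimension[OF n \<sigma>(1) d] by (auto simp: \<rho>_def)
      let ?A = "\<alpha> n"
      define T where "T = ?A \<inter> nball N 0 R"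
      have A: "finite ?A" and T: "finite T" "T \<subseteq> ?A" using \<alpha>[OF n] by (auto simp: T_def)
      have "2 \<le> real (card T)"
        using large card c(1) by (simp add: T_def field_simps)
      then have "2 \<le> card T" by simp
      then have other: "?A - {a} \<noteq> {}" for a
        using card_mono[OF A T(2)] card_mono[of "{a}" ?A] by auto
      define S where "S = {a \<in> T. \<rho> < ndist N a (?A - {a})}"
      have S: "finite S" "S \<subseteq> T" using T by (auto simp: S_def)
      have "card S * (\<rho> / 2) ^ DIM(real ^ 'd) \<le> (R + \<rho> / 2) ^ DIM(real ^ 'd)"
      proof (rule card_separated_le[OF N S(1) _ less_imp_le[OF c(2)] \<rho>(1)])
        show "S \<subseteq> nball N 0 R" using S by (auto simp: T_def)
        fix x y assume xy: "x \<in> S" "y \<in> S" "x \<noteq> y"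
        have "\<rho> < ndist N x (?A - {x})" using xy by (simp add: S_def)
        also have "\<dots> \<le> N (x - y)" using xy A S(2) T(2) by (intro ndist_le) auto
        finally show "\<rho> < N (x - y)" .
      qed
      then have "card S * (\<rho> / 2) ^ d \<le> (R + \<rho> / 2) ^ d" by (simp add: d_def)
      also have "\<dots> \<le> (R + 1) ^ d" using \<rho> c(2) by (intro power_mono) auto
      finally have "card S * (\<rho> / 2) ^ d * 2 ^ d \<le> (R + 1) ^ d * 2 ^ d"
        by (rule mult_right_mono) simp
      moreover have "card S * (\<rho> / 2) ^ d * 2 ^ d = card S * \<rho> ^ d"
        by (simp add: power_divide)
      moreover have "(R + 1) ^ d * 2 ^ d = (2 * (R + 1)) ^ d"
        by (simp only: power_mult_distrib mult.commute)
      ultimately have "card S * \<rho> ^ d \<le> (2 * (R + 1)) ^ d"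
        by simp
      then have "(2 * (R + 1)) ^ d * (card S * (2 / (c * n))) \<le> (2 * (R + 1)) ^ d * 1"
        using n by (simp add: \<rho>(3) \<sigma>(2) field_simps)
      then have "card S * (2 / (c * n)) \<le> 1"
        using c(2) by (subst (asm) mult_le_cancel_left_pos) auto
      then have "real (card S) \<le> c * n / 2"
        using c(1) n by (simp add: field_simps)
      moreover have "real (card (T - S)) = real (card T) - real (card S)"
        using S T card_mono[OF T(1) S(2)] by (simp add: card_Diff_subset of_nat_diff)
      ultimately have many: "c * n / 2 \<le> card (T - S)"
        using card by (simp add: T_def)
      have "0 < c * n / 2" using c(1) n by simp
      then have "0 < card (T - S)" using many by linarith
      then have "T - S \<noteq> {}" by (metis card.empty less_irrefl)
      then obtain a where a: "a \<in> T - S"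
          "\<And>a'. a' \<in> T - S \<Longrightarrow> removal_cost N r P ?A \<pi> a \<le> removal_cost N r P ?A \<pi> a'"
        using arg_min_if_finite[of "T - S" "removal_cost N r P ?A \<pi>"] T(1)
        by (meson finite_Diff not_le)
      have "ennreal (c * n / 2) * removal_cost N r P ?A \<pi> a
          \<le> of_nat (card (T - S)) * removal_cost N r P ?A \<pi> a"
        using many by (intro mult_right_mono) (auto simp: ennreal_of_nat_eq_real_of_nat intro: ennreal_leI)
      also have "\<dots> \<le> (\<Sum>a\<in>T - S. removal_cost N r P ?A \<pi> a)"
        using a(2) by (intro sum_bounded_below)
      also have "\<dots> \<le> distortion N r P ?A + ennreal (\<rho> powr r)"
        using other T(2) by (intro sum_removal_cost_le[OF N r P sP A \<pi>]) (auto simp: S_def)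
      also have "\<dots> \<le> ennreal (C * n powr (- (r / d))) + ennreal (\<sigma> powr r * n powr (- (r / d)))"
        using C(2)[OF n] \<rho>(4) by (intro add_mono) (auto simp: d_def)
      also have "\<dots> = ennreal ((C + \<sigma> powr r) * n powr (- (r / d)))"
        using C(1) by (simp add: ennreal_plus[symmetric] distrib_right del: ennreal_plus)
      finally have "removal_cost N r P ?A \<pi> a \<le> ennreal ((C + \<sigma> powr r) * n powr (- (r / d)) / (c * n / 2))"
        using c(1) n by (intro ennreal_mult_le_imp_le_divide) auto
      also have "(C + \<sigma> powr r) * n powr (- (r / d)) / (c * n / 2) = C' * n powr (- (1 + r / d))"
        using n by (simp add: C'_def powr_diff powr_minus field_simps)
      finally show "\<exists>a\<in>\<alpha> n. \<alpha> n - {a} \<noteq> {} \<and>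
          removal_cost N r P (\<alpha> n) \<pi> a \<le> ennreal (C' * n powr (- (1 + r / CARD('d))))"
        using a(1) T(2) other by (auto simp: d_def)
    qed
  qed
qed

section \<open>The pointwise bound by the maximal function\<close>

lemma ennpowr_mono: "x \<le> y \<Longrightarrow> 0 \<le> p \<Longrightarrow> ennpowr x p \<le> ennpowr y p"
  by (auto simp: ennpowr_def top_unique intro!: ennreal_leI powr_mono2 enn2real_mono simp: less_top)

lemma ennpowr_ennreal: "0 \<le> t \<Longrightarrow> ennpowr (ennreal t) p = ennreal (t powr p)"
  by (simp add: ennpowr_def)

text \<open>The central estimate: exchanging a cheap point for an arbitrary \<open>x\<close> turns the average rate of the
  distortion into a bound at every \<open>x\<close>.\<close>

lemma optimal_quantizers_pointwise_rate:
  fixes N :: "real ^ 'd \<Rightarrow> real" and f :: "real ^ 'd \<Rightarrow> real" and \<alpha> :: "nat \<Rightarrow> (real ^ 'd) set"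
  assumes N: "is_norm N" and r: "0 < r" and \<eta>: "0 < \<eta>" and b: "0 < b" "b < 1 / 2"
    and f: "f \<in> borel_measurable borel" "\<And>x. 0 \<le> f x"
    and P: "prob_space P" "P = density lborel (\<lambda>x. ennreal (f x))"
    and mom: "(\<integral>\<^sup>+ x. ennreal (N x powr (r + \<eta>)) \<partial>P) < \<infinity>"
    and opt: "optimal_quantizers N r P \<alpha>"
  obtains C where "0 < C"
    "\<forall>\<^sub>F n in sequentially. \<forall>x. ndist N x (\<alpha> n) powr r * measure P (nball N x (b * ndist N x (\<alpha> n)))
        \<le> C * n powr (- (1 + r / CARD('d)))"
proof -
  interpret P: prob_space P by (rule P)
  have sP: "sets P = sets borel" by (simp add: P(2))
  have \<alpha>: "finite (\<alpha> n) \<and> \<alpha> n \<noteq> {}" "\<alpha> n \<in> quantizers n" if "1 \<le> n" for n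
    using opt that by (auto simp: optimal_quantizers_def quantizers_def)
  obtain C0 where C0: "0 < C0"
    "\<And>n. 1 \<le> n \<Longrightarrow> distortion N r P (\<alpha> n) \<le> ennreal (C0 * n powr (- (r / CARD('d))))"
    by (rule optimal_distortion_rate[OF N r \<eta> P(1) sP mom opt]) (blast intro: that)
  obtain c R where c: "0 < c" "0 < R" "\<forall>\<^sub>F n in sequentially. c * real n \<le> card (\<alpha> n \<inter> nball N 0 R)"
    by (rule card_points_in_bounded_region[OF N r f P \<alpha>(1) C0]) (blast intro: that)
  obtain C1 where C1: "0 < C1"
    "\<forall>\<^sub>F n in sequentially. \<forall>\<pi>. nearest_neighbour_projection N (\<alpha> n) \<pi> \<longrightarrow>
       (\<exists>a\<in>\<alpha> n. \<alpha> n - {a} \<noteq> {} \<and>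
          removal_cost N r P (\<alpha> n) \<pi> a \<le> ennreal (C1 * n powr (- (1 + r / CARD('d)))))"
    by (rule exists_cheap_point[OF N r P(1) sP conjunct1[OF \<alpha>(1)] C0 c]) (blast intro: that)
  define \<kappa> where "\<kappa> = (1 - b) powr r - b powr r"
  have \<kappa>: "0 < \<kappa>" using b r by (simp add: \<kappa>_def powr_less_mono2)
  show ?thesis
  proof
    show "0 < 2 powr r * C1 / \<kappa>" using C1(1) \<kappa> by simp
    show "\<forall>\<^sub>F n in sequentially. \<forall>x. ndist N x (\<alpha> n) powr r * measure P (nball N x (b * ndist N x (\<alpha> n)))
        \<le> 2 powr r * C1 / \<kappa> * n powr (- (1 + r / CARD('d)))"
      using C1(2) eventually_ge_at_top[of 1]
    proof (eventually_elim, intro allI)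
      fix n :: nat and x
      assume cheap: "\<forall>\<pi>. nearest_neighbour_projection N (\<alpha> n) \<pi> \<longrightarrow>
          (\<exists>a\<in>\<alpha> n. \<alpha> n - {a} \<noteq> {} \<and>
            removal_cost N r P (\<alpha> n) \<pi> a \<le> ennreal (C1 * n powr (- (1 + r / CARD('d)))))"
        and n: "1 \<le> n"
      let ?A = "\<alpha> n"
      obtain \<pi> where \<pi>: "nearest_neighbour_projection N ?A \<pi>"
        using nearest_neighbour_projection_exists[OF N, of ?A] \<alpha>(1)[OF n] by blast
      then obtain a where a: "a \<in> ?A" "?A - {a} \<noteq> {}"
          "removal_cost N r P ?A \<pi> a \<le> ennreal (C1 * n powr (- (1 + r / CARD('d))))"
        using cheap by blast
      have "card (insert x (?A - {a})) \<le> card ?A"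
        using a(1) \<alpha>(1)[OF n] card_insert_le_m1[of "card ?A" "?A - {a}" x]
        by (simp add: card_gt_0_iff)
      then have "insert x (?A - {a}) \<in> quantizers n"
        using \<alpha>[OF n] by (auto simp: quantizers_def)
      then have opt': "distortion N r P ?A \<le> distortion N r P (insert x (?A - {a}))"
        using opt n by (auto simp: optimal_quantizers_def intro: INF_lower)
      have fin: "distortion N r P ?A < \<infinity>"
        using order_le_less_trans[OF C0(2)[OF n] ennreal_less_top] by simp
      have "ennreal (\<kappa> * ndist N x ?A powr r) * emeasure P (nball N x (b * ndist N x ?A))
          \<le> ennreal (2 powr r) * removal_cost N r P ?A \<pi> a"
        unfolding \<kappa>_def
        using exchange_inequality[OF N r b sP conjunct1[OF \<alpha>(1)[OF n]] a(1,2) \<pi> fin opt'] .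
      also have "\<dots> \<le> ennreal (2 powr r) * ennreal (C1 * n powr (- (1 + r / CARD('d))))"
        by (intro mult_left_mono a(3)) simp
      finally have "ennreal (\<kappa> * ndist N x ?A powr r * measure P (nball N x (b * ndist N x ?A)))
          \<le> ennreal (2 powr r * (C1 * n powr (- (1 + r / CARD('d)))))"
        using \<kappa> C1(1) by (simp add: P.emeasure_eq_measure ennreal_mult[symmetric])
      then have "\<kappa> * ndist N x ?A powr r * measure P (nball N x (b * ndist N x ?A))
          \<le> 2 powr r * (C1 * n powr (- (1 + r / CARD('d))))"
        using C1(1) by (subst (asm) ennreal_le_iff) auto
      then show "ndist N x ?A powr r * measure P (nball N x (b * ndist N x ?A))
          \<le> 2 powr r * C1 / \<kappa> * n powr (- (1 + r / CARD('d)))"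
        using \<kappa> by (simp add: field_simps)
    qed
  qed
qed

text \<open>The volume of the ball of radius \<open>b D\<close> is proportional to \<open>D ^ d\<close>. Multiplying the bound on
  \<open>D powr r * m\<close> by it yields \<open>n powr (1 + r / d) * D powr (d + r) \<le> const * volume / m\<close>, and the claim is
  the power \<open>s / (d + r)\<close> of this.\<close>

lemma powr_rate_of_ball_quotient:
  fixes N :: "real ^ 'd \<Rightarrow> real" and r s b C D m :: real and n :: nat
  assumes N: "is_norm N" and r: "0 < r" "0 < s" and b: "0 < b" and C: "0 < C"
    and n: "1 \<le> n" and D: "0 < D" and m: "0 < m"
    and bound: "D powr r * m \<le> C * n powr (- (1 + r / CARD('d)))"
  shows "n powr (s / CARD('d)) * D powr s
    \<le> (C / (measure lborel (nball N 0 1) * b ^ CARD('d))) powr (s / (CARD('d) + r))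
       * (measure lborel (nball N x (b * D)) / m) powr (s / (CARD('d) + r))"
proof -
  define d where "d = CARD('d)"
  have d: "0 < d" by (simp add: d_def)
  define v where "v = measure lborel (nball N (0::real ^ 'd) 1)"
  have v: "0 < v" unfolding v_def by (rule measure_nball_pos[OF N])
  have L: "measure lborel (nball N x (b * D)) = v * b ^ d * D ^ d"
    using emeasure_nball[OF N, of "b * D" x] b D v unfolding measure_def[of _ "nball N x (b * D)"]
    by (simp add: v_def[symmetric] d_def power_mult_distrib mult.assoc)
  define p where "p = s / (d + r)"
  have p: "0 < p" using r by (simp add: p_def add_nonneg_pos)
  have e: "(1 + r / d) * p = s / d" "(d + r) * p = s"
  proof -
    have "real d + r \<noteq> 0" using r(1) by simp
    moreover have "1 + r / d = (d + r) / d" using d by (simp add: add_divide_distrib)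
    ultimately show "(1 + r / d) * p = s / d" "(d + r) * p = s" by (simp_all add: p_def)
  qed
  have "D ^ d = D powr d" using D by (simp add: powr_realpow)
  then have Ddr: "D powr (d + r) * m \<le> C * n powr (- (1 + r / d)) * D ^ d"
    using mult_right_mono[OF bound, of "D ^ d"] D by (simp add: powr_add d_def mult_ac)
  then have "n powr (1 + r / d) * D powr (d + r) * m
      \<le> n powr (1 + r / d) * (C * n powr (- (1 + r / d)) * D ^ d)"
    using mult_left_mono[OF Ddr, of "n powr (1 + r / d)"] by (simp add: mult.assoc)
  also have "\<dots> = C * D ^ d"
  proof -
    have "n powr (1 + r / d) * n powr (- (1 + r / d)) = 1"
      using n by (simp only: powr_add[symmetric]) simp
    then show ?thesis by (simp add: mult.left_commute mult.assoc)
  qed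
  finally have "n powr (1 + r / d) * D powr (d + r) \<le> C * D ^ d / m"
    using m by (simp add: pos_le_divide_eq)
  also have "\<dots> = C / (v * b ^ d) * (v * b ^ d * D ^ d / m)"
    using v b by simp
  finally have "(n powr (1 + r / d) * D powr (d + r)) powr p
      \<le> (C / (v * b ^ d) * (v * b ^ d * D ^ d / m)) powr p"
    using p by (intro powr_mono2) auto
  then have "n powr (s / d) * D powr s \<le> (C / (v * b ^ d)) powr p * (v * b ^ d * D ^ d / m) powr p"
    by (simp only: powr_mult powr_powr e)
  then show ?thesis unfolding L by (simp add: v_def d_def p_def)
qed

text \<open>The previous bound in \<open>[0, \<infinity>]\<close>, where it also makes sense if \<open>x\<close> belongs to \<open>A\<close> (the left-hand side
  is \<open>0\<close>) or if the ball has mass \<open>0\<close> (the quotient is \<open>\<infinity>\<close>).\<close>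

lemma rate_le_ball_quotient:
  fixes N :: "real ^ 'd \<Rightarrow> real" and r s b C :: real and n :: nat
  assumes N: "is_norm N" and r: "0 < r" "0 < s" and b: "0 < b" and C: "0 < C" and n: "1 \<le> n"
    and A: "finite A" "A \<noteq> {}" and P: "finite_measure P"
    and bound: "ndist N x A powr r * measure P (nball N x (b * ndist N x A)) \<le> C * n powr (- (1 + r / CARD('d)))"
  shows "ennreal (n powr (s / CARD('d)) * ndist N x A powr s)
    \<le> ennreal ((C / (measure lborel (nball N 0 1) * b ^ CARD('d))) powr (s / (CARD('d) + r)))
       * ennpowr (emeasure lborel (nball N x (b * ndist N x A)) / emeasure P (nball N x (b * ndist N x A)))
           (s / (CARD('d) + r))"
proof (cases "ndist N x A = 0")
  case True
  then show ?thesis by simp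
next
  case False
  interpret P: finite_measure P by (rule P)
  define D where "D = ndist N x A"
  define B where "B = nball N x (b * D)"
  define p where "p = s / (CARD('d) + r)"
  define E where "E = C / (measure lborel (nball N 0 1) * b ^ CARD('d))"
  have D: "0 < D" using False ndist_nonneg[OF N A, of x] by (simp add: D_def)
  have v: "0 < measure lborel (nball N (0::real ^ 'd) 1)" by (rule measure_nball_pos[OF N])
  have E: "0 < E" using C b v by (simp add: E_def)
  have L: "emeasure lborel B = ennreal (measure lborel B)" "0 < measure lborel B"
    using emeasure_nball[OF N, of "b * D" x] b D v by (auto simp: B_def measure_def)
  have "ennreal (n powr (s / CARD('d)) * D powr s)
      \<le> ennreal (E powr p) * ennpowr (emeasure lborel B / emeasure P B) p"
  proof (cases "measure P B = 0")
    case True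
    then have "emeasure lborel B / emeasure P B = \<infinity>"
      using L by (simp add: P.emeasure_eq_measure ennreal_divide_zero)
    then show ?thesis using E by (simp add: ennpowr_def ennreal_mult_top)
  next
    case False
    then have m: "0 < measure P B" by (simp add: zero_less_measure_iff)
    have "n powr (s / CARD('d)) * D powr s \<le> E powr p * (measure lborel B / measure P B) powr p"
      using powr_rate_of_ball_quotient[OF N r b C n D m, of x] bound
      by (simp add: E_def p_def B_def D_def)
    then show ?thesis
      using m L
      by (simp add: P.emeasure_eq_measure divide_ennreal ennpowr_ennreal ennreal_mult[symmetric] ennreal_leI)
  qed
  then show ?thesis by (simp add: E_def p_def B_def D_def)
qed

lemma ball_quotient_le_maximal_fun:
  "1 \<le> n \<Longrightarrow> emeasure lborel (nball N x (b * ndist N x (\<alpha> n))) / emeasure P (nball N x (b * ndist N x (\<alpha> n)))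
     \<le> maximal_fun N P \<alpha> b x"
  unfolding maximal_fun_def by (rule SUP_upper) simp

section \<open>The limit superior under the dilated distribution\<close>

lemma nn_integral_dilated_measure:
  fixes f :: "real ^ 'd \<Rightarrow> real"
  assumes P: "P = density lborel (\<lambda>x. ennreal (f x))" and f [measurable]: "f \<in> borel_measurable borel"
    and \<theta>: "0 < \<theta>" and h [measurable]: "h \<in> borel_measurable borel"
  shows "(\<integral>\<^sup>+ z. h z \<partial>dilated_measure \<theta> \<mu> P)
    = ennreal (\<theta> ^ CARD('d)) * (\<integral>\<^sup>+ z. ennreal (dilated_fun \<theta> \<mu> f z) * h z \<partial>lborel)"
proof -
  let ?g = "\<lambda>x. ennreal (f x) * h ((x - \<mu>) /\<^sub>R \<theta> + \<mu>)"
  have "(\<integral>\<^sup>+ z. h z \<partial>dilated_measure \<theta> \<mu> P) = (\<integral>\<^sup>+ x. ?g x \<partial>lborel)"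
    unfolding dilated_measure_def P by (subst nn_integral_distr) (simp_all add: nn_integral_density)
  also have "\<dots> = (\<integral>\<^sup>+ x. ?g x \<partial>density (distr lborel borel (\<lambda>z. (\<mu> - \<theta> *\<^sub>R \<mu>) + \<theta> *\<^sub>R z))
      (\<lambda>_. \<bar>\<theta>\<bar> ^ DIM(real ^ 'd)))"
    using \<theta> by (subst lborel_affine[of \<theta> "\<mu> - \<theta> *\<^sub>R \<mu>", symmetric]) auto
  also have "\<dots> = (\<integral>\<^sup>+ z. ennreal (\<theta> ^ CARD('d)) * ?g ((\<mu> - \<theta> *\<^sub>R \<mu>) + \<theta> *\<^sub>R z) \<partial>lborel)"
    using \<theta> by (subst nn_integral_density; (subst nn_integral_distr)?) (simp_all add: ennreal_power)
  also have "\<dots> = ennreal (\<theta> ^ CARD('d)) * (\<integral>\<^sup>+ z. ?g ((\<mu> - \<theta> *\<^sub>R \<mu>) + \<theta> *\<^sub>R z) \<partial>lborel)"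
    by (rule nn_integral_cmult) measurable
  also have "(\<lambda>z. ?g ((\<mu> - \<theta> *\<^sub>R \<mu>) + \<theta> *\<^sub>R z)) = (\<lambda>z. ennreal (dilated_fun \<theta> \<mu> f z) * h z)"
  proof
    fix z
    have "(\<mu> - \<theta> *\<^sub>R \<mu>) + \<theta> *\<^sub>R z = \<mu> + \<theta> *\<^sub>R (z - \<mu>)" by (simp add: algebra_simps)
    moreover have "(\<mu> + \<theta> *\<^sub>R (z - \<mu>) - \<mu>) /\<^sub>R \<theta> + \<mu> = z" using \<theta> by simp
    ultimately show "?g ((\<mu> - \<theta> *\<^sub>R \<mu>) + \<theta> *\<^sub>R z) = ennreal (dilated_fun \<theta> \<mu> f z) * h z"
      by (simp only: dilated_fun_def)
  qed
  finally show ?thesis .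
qed

text \<open>The distance to the dilated set is \<open>\<theta>\<close> times the distance of the contracted point to the original
  set, and the contracted variable has distribution \<open>dilated_measure \<theta> \<mu> P\<close>.\<close>

lemma Lp_norm_pow_voronoi_dilated:
  fixes N :: "real ^ 'd \<Rightarrow> real"
  assumes N: "is_norm N" and X [measurable]: "X \<in> borel_measurable M" and P: "P = distr M borel X"
    and A: "finite A" "A \<noteq> {}" and \<theta>: "0 < \<theta>"
    and Y: "voronoi_quantization N M X (dilated_set \<theta> \<mu> A) Y"
  shows "Lp_norm_pow N M s (\<lambda>\<omega>. X \<omega> - Y \<omega>)
    = ennreal (\<theta> powr s) * (\<integral>\<^sup>+ z. ennreal (ndist N z A powr s) \<partial>dilated_measure \<theta> \<mu> P)"
proof -
  note [measurable] = ndist_borel_measurable[OF N A(1)]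
  obtain \<pi> where \<pi>: "nearest_neighbour_projection N (dilated_set \<theta> \<mu> A) \<pi>"
      "\<And>\<omega>. \<omega> \<in> space M \<Longrightarrow> Y \<omega> = \<pi> (X \<omega>)"
    using Y by (auto simp: voronoi_quantization_def)
  have "N (X \<omega> - Y \<omega>) = \<theta> * ndist N ((X \<omega> - \<mu>) /\<^sub>R \<theta> + \<mu>) A" if "\<omega> \<in> space M" for \<omega>
    using \<pi>(1) \<pi>(2)[OF that] ndist_dilated_set[OF N A \<theta>, of "X \<omega>" \<mu>]
    by (simp add: nearest_neighbour_projection_def)
  then have "Lp_norm_pow N M s (\<lambda>\<omega>. X \<omega> - Y \<omega>)
      = (\<integral>\<^sup>+ \<omega>. ennreal (\<theta> powr s) * ennreal (ndist N ((X \<omega> - \<mu>) /\<^sub>R \<theta> + \<mu>) A powr s) \<partial>M)"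
    unfolding Lp_norm_pow_def by (intro nn_integral_cong) (simp add: powr_mult ennreal_mult)
  also have "\<dots> = ennreal (\<theta> powr s) * (\<integral>\<^sup>+ \<omega>. ennreal (ndist N ((X \<omega> - \<mu>) /\<^sub>R \<theta> + \<mu>) A powr s) \<partial>M)"
    by (rule nn_integral_cmult) measurable
  also have "(\<integral>\<^sup>+ \<omega>. ennreal (ndist N ((X \<omega> - \<mu>) /\<^sub>R \<theta> + \<mu>) A powr s) \<partial>M)
      = (\<integral>\<^sup>+ z. ennreal (ndist N z A powr s) \<partial>dilated_measure \<theta> \<mu> P)"
    unfolding dilated_measure_def P by (simp add: nn_integral_distr)
  finally show ?thesis .
qed

text \<open>The factors \<open>2\<close> around the limit \<open>1 / t\<close> are convenient: they avoid a passage to the limit in the power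
  of the quotient and only enter the constant.\<close>

lemma eventually_ball_quotient_bounds:
  fixes N :: "'a::euclidean_space \<Rightarrow> real" and \<rho> :: "nat \<Rightarrow> real"
  assumes N: "is_norm N" and P: "finite_measure P" and t: "0 < t"
    and \<rho>: "\<rho> \<longlonglongrightarrow> 0" "\<forall>\<^sub>F n in sequentially. 0 < \<rho> n"
    and lim: "((\<lambda>\<rho>. measure P (nball N x \<rho>) / measure lborel (nball N x \<rho>)) \<longlongrightarrow> t) (at_right 0)"
  shows "\<forall>\<^sub>F n in sequentially.
    emeasure lborel (nball N x (\<rho> n)) / emeasure P (nball N x (\<rho> n)) \<le> ennreal (2 / t) \<and>
    ennreal (1 / (2 * t)) \<le> emeasure lborel (nball N x (\<rho> n)) / emeasure P (nball N x (\<rho> n))"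
proof -
  interpret P: finite_measure P by (rule P)
  have "filterlim \<rho> (at_right 0) sequentially"
    using \<rho> by (rule tendsto_imp_filterlim_at_right)
  from filterlim_compose[OF lim this]
  have "(\<lambda>n. measure P (nball N x (\<rho> n)) / measure lborel (nball N x (\<rho> n))) \<longlonglongrightarrow> t" .
  then have "\<forall>\<^sub>F n in sequentially. t / 2 < measure P (nball N x (\<rho> n)) / measure lborel (nball N x (\<rho> n))"
    "\<forall>\<^sub>F n in sequentially. measure P (nball N x (\<rho> n)) / measure lborel (nball N x (\<rho> n)) < 2 * t"
    using t by (auto dest: order_tendstoD(1)[of _ t _ "t / 2"] order_tendstoD(2)[of _ t _ "2 * t"])
  then show ?thesis
    using \<rho>(2)
  proof eventually_elim
    fix n
    let ?B = "nball N x (\<rho> n)"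
    assume lo: "t / 2 < measure P ?B / measure lborel ?B" and hi: "measure P ?B / measure lborel ?B < 2 * t"
      and \<rho>: "0 < \<rho> n"
    have L: "emeasure lborel ?B = ennreal (measure lborel ?B)" "0 < measure lborel ?B"
      using emeasure_nball[OF N, of "\<rho> n" x] \<rho> measure_nball_pos[OF N] by (auto simp: measure_def)
    have "t / 2 * measure lborel ?B < measure P ?B"
      using lo L(2) by (simp add: pos_less_divide_eq)
    moreover have "0 < t / 2 * measure lborel ?B" using t L(2) by simp
    ultimately have m: "0 < measure P ?B" "t / 2 * measure lborel ?B \<le> measure P ?B" by linarith+
    have "measure P ?B \<le> 2 * t * measure lborel ?B"
      using hi L(2) by (simp add: pos_divide_less_eq)
    then have "measure lborel ?B / measure P ?B \<le> 2 / t" "1 / (2 * t) \<le> measure lborel ?B / measure P ?B"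
      using m t by (simp_all add: field_simps)
    moreover have "emeasure lborel ?B / emeasure P ?B = ennreal (measure lborel ?B / measure P ?B)"
      using m L by (simp add: P.emeasure_eq_measure divide_ennreal)
    ultimately show "emeasure lborel ?B / emeasure P ?B \<le> ennreal (2 / t) \<and>
        ennreal (1 / (2 * t)) \<le> emeasure lborel ?B / emeasure P ?B"
      by (simp add: ennreal_leI)
  qed
qed

lemma tendsto_0_of_powr_bound:
  fixes D :: "nat \<Rightarrow> real"
  assumes s: "0 < s" and d: "0 < d" and D: "\<And>n. 1 \<le> n \<Longrightarrow> 0 \<le> D n"
    and bound: "\<forall>\<^sub>F n in sequentially. n powr (s / d) * D n powr s \<le> W"
  shows "D \<longlonglongrightarrow> 0"
proof (rule tendsto_sandwich)
  show "\<forall>\<^sub>F n in sequentially. 0 \<le> D n"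
    using eventually_ge_at_top[of 1] by eventually_elim (rule D)
  show "\<forall>\<^sub>F n in sequentially. D n \<le> W powr (1 / s) * n powr (- (1 / d))"
    using bound eventually_ge_at_top[of 1]
  proof eventually_elim
    fix n :: nat assume h: "n powr (s / d) * D n powr s \<le> W" and n: "1 \<le> n"
    have "(n powr (s / d) * D n powr s) powr (1 / s) \<le> W powr (1 / s)"
      using h s by (intro powr_mono2) auto
    moreover have "(n powr (s / d) * D n powr s) powr (1 / s) = n powr (1 / d) * D n"
      using s D[OF n] by (simp add: powr_mult powr_powr)
    ultimately show "D n \<le> W powr (1 / s) * n powr (- (1 / d))"
      using n by (simp add: powr_minus field_simps)
  qed
  have "((\<lambda>n. W powr (1 / s) * real n powr (- (1 / d))) \<longlongrightarrow> W powr (1 / s) * 0) sequentially"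
    using d by (intro tendsto_mult tendsto_const tendsto_neg_powr filterlim_real_sequentially) auto
  then show "((\<lambda>n. W powr (1 / s) * real n powr (- (1 / d))) \<longlongrightarrow> 0) sequentially" by simp
qed simp

text \<open>At a point where the maximal function is finite, the rate itself forces the distances to the
  quantizers to \<open>0\<close>, so the differentiation theorem applies along the radii \<open>b * ndist N x (\<alpha> n)\<close>.
  It controls the rate from above by \<open>t powr (- p)\<close>; and, as each quotient is below the maximal
  function, it also bounds \<open>t powr (- p)\<close> by the maximal function, whence the integrability of the
  limit. The condition \<open>x \<notin> \<alpha> n\<close> excludes degenerate balls.\<close>

lemma local_limsup_and_maximal_fun_bound:
  fixes N :: "real ^ 'd \<Rightarrow> real" and \<alpha> :: "nat \<Rightarrow> (real ^ 'd) set"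
  assumes N: "is_norm N" and P: "finite_measure P" and s: "0 < s" and p: "0 < p" and b: "0 < b" and t: "0 < t"
    and \<alpha>: "\<And>n. 1 \<le> n \<Longrightarrow> finite (\<alpha> n) \<and> \<alpha> n \<noteq> {} \<and> x \<notin> \<alpha> n"
    and fin: "maximal_fun N P \<alpha> b x < \<infinity>"
    and lim: "((\<lambda>\<rho>. measure P (nball N x \<rho>) / measure lborel (nball N x \<rho>)) \<longlongrightarrow> t) (at_right 0)"
    and rate: "\<forall>\<^sub>F n in sequentially. ennreal (n powr (s / CARD('d)) * ndist N x (\<alpha> n) powr s)
      \<le> ennreal E * ennpowr (emeasure lborel (nball N x (b * ndist N x (\<alpha> n)))
           / emeasure P (nball N x (b * ndist N x (\<alpha> n)))) p"
    and E: "0 \<le> E"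
  shows "\<forall>\<^sub>F n in sequentially. n powr (s / CARD('d)) * ndist N x (\<alpha> n) powr s \<le> E * 2 powr p * t powr (- p)"
    and "ennreal (t powr (- p)) \<le> ennreal (2 powr p) * ennpowr (maximal_fun N P \<alpha> b x) p"
proof -
  let ?D = "\<lambda>n. ndist N x (\<alpha> n)"
  let ?q = "\<lambda>n. emeasure lborel (nball N x (b * ?D n)) / emeasure P (nball N x (b * ?D n))"
  have D: "0 < ?D n" if "1 \<le> n" for n
    using \<alpha>[OF that] ndist_nonneg[OF N, of "\<alpha> n" x] ndist_eq_0_iff[OF N, of "\<alpha> n" x] by auto
  obtain W where W: "ennreal E * ennpowr (maximal_fun N P \<alpha> b x) p = ennreal W" "0 \<le> W"
    using fin E by (auto simp: ennpowr_def ennreal_mult[symmetric] less_top)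
  have "\<forall>\<^sub>F n in sequentially. n powr (s / CARD('d)) * ?D n powr s \<le> W"
    using rate eventually_ge_at_top[of 1]
  proof eventually_elim
    fix n :: nat
    assume h: "ennreal (n powr (s / CARD('d)) * ?D n powr s) \<le> ennreal E * ennpowr (?q n) p" and n: "1 \<le> n"
    note h
    also have "ennreal E * ennpowr (?q n) p \<le> ennreal E * ennpowr (maximal_fun N P \<alpha> b x) p"
      using p by (intro mult_left_mono ennpowr_mono ball_quotient_le_maximal_fun n) auto
    finally show "n powr (s / CARD('d)) * ?D n powr s \<le> W"
      unfolding W(1) using W(2) by simp
  qed
  then have "?D \<longlonglongrightarrow> 0"
    using s D by (intro tendsto_0_of_powr_bound[of s "real CARD('d)"]) (auto intro: less_imp_le)
  then have "(\<lambda>n. b * ?D n) \<longlonglongrightarrow> 0"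
    using tendsto_mult_left[of ?D 0 sequentially b] by simp
  moreover have "\<forall>\<^sub>F n in sequentially. 0 < b * ?D n"
    using eventually_ge_at_top[of 1] by eventually_elim (use D b in simp)
  ultimately have bounds: "\<forall>\<^sub>F n in sequentially. ?q n \<le> ennreal (2 / t) \<and> ennreal (1 / (2 * t)) \<le> ?q n"
    by (intro eventually_ball_quotient_bounds[OF N P t _ _ lim])
  show "\<forall>\<^sub>F n in sequentially. n powr (s / CARD('d)) * ?D n powr s \<le> E * 2 powr p * t powr (- p)"
    using rate bounds
  proof eventually_elim
    fix n :: nat
    assume h: "ennreal (n powr (s / CARD('d)) * ?D n powr s) \<le> ennreal E * ennpowr (?q n) p"
      and q: "?q n \<le> ennreal (2 / t) \<and> ennreal (1 / (2 * t)) \<le> ?q n"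
    note h
    also have "ennreal E * ennpowr (?q n) p \<le> ennreal E * ennpowr (ennreal (2 / t)) p"
      using p q by (intro mult_left_mono ennpowr_mono) auto
    also have "\<dots> = ennreal (E * 2 powr p * t powr (- p))"
      using t E by (simp add: ennpowr_ennreal ennreal_mult[symmetric] powr_divide powr_minus_divide)
    finally show "n powr (s / CARD('d)) * ?D n powr s \<le> E * 2 powr p * t powr (- p)"
      using E by (subst (asm) ennreal_le_iff) auto
  qed
  have "\<exists>n. 1 \<le> n \<and> ennreal (1 / (2 * t)) \<le> ?q n"
    using eventually_happens'[OF sequentially_bot eventually_conj[OF eventually_ge_at_top[of 1] bounds]] by blast
  then obtain n where n: "1 \<le> n" "ennreal (1 / (2 * t)) \<le> ?q n" by blast
  note n(2)
  also have "?q n \<le> maximal_fun N P \<alpha> b x"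
    by (rule ball_quotient_le_maximal_fun[OF n(1)])
  finally have le: "ennreal (1 / (2 * t)) \<le> maximal_fun N P \<alpha> b x" .
  have "ennreal (t powr (- p)) = ennreal (2 powr p) * ennpowr (ennreal (1 / (2 * t))) p"
    using t by (simp add: ennpowr_ennreal ennreal_mult[symmetric] powr_divide powr_mult powr_minus_divide)
  also have "\<dots> \<le> ennreal (2 powr p) * ennpowr (maximal_fun N P \<alpha> b x) p"
    using p le by (intro mult_left_mono ennpowr_mono) auto
  finally show "ennreal (t powr (- p)) \<le> ennreal (2 powr p) * ennpowr (maximal_fun N P \<alpha> b x) p" .
qed

theorem theorem3p2:
  fixes N :: "real ^ 'd \<Rightarrow> real"
    and M :: "'w measure" and X :: "'w \<Rightarrow> real ^ 'd"
    and P :: "(real ^ 'd) measure" and f :: "real ^ 'd \<Rightarrow> real"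
    and \<alpha> :: "nat \<Rightarrow> (real ^ 'd) set" and \<mu> :: "real ^ 'd"
    and r s b :: real
  assumes "is_norm N"
    and "0 < r" and "r < s"
    and "prob_space M" and "X \<in> borel_measurable M"
    and "P = distr M borel X"
    and "f \<in> borel_measurable borel" and "\<And>x. 0 \<le> f x"
    and "P = density lborel (\<lambda>x. ennreal (f x))"
    and "\<exists>\<eta>>0. Lp_norm_pow N M (r + \<eta>) X < \<infinity>"
    and "optimal_quantizers N r P \<alpha>"
    and "0 < b" and "b < 1 / 2"
  shows "\<exists>C>0. \<forall>\<theta>>0.
           absolutely_continuous P (dilated_measure \<theta> \<mu> P) \<longrightarrow>
           in_L1 (dilated_measure \<theta> \<mu> P)
             (\<lambda>x. ennpowr (maximal_fun N P \<alpha> b x) (s / (real CARD('d) + r))) \<longrightarrow>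
           (\<forall>Xhat. (\<forall>n\<ge>1. voronoi_quantization N M X (dilated_set \<theta> \<mu> (\<alpha> n)) (Xhat n)) \<longrightarrow>
              limsup (\<lambda>n. ennreal (real n powr (s / real CARD('d))) *
                          Lp_norm_pow N M s (\<lambda>\<omega>. X \<omega> - Xhat n \<omega>))
                \<le> ennreal (\<theta> powr (s + real CARD('d)) * C) * dilation_integral f r s \<theta> \<mu>) \<and>
           ennreal (\<theta> powr (s + real CARD('d)) * C) * dilation_integral f r s \<theta> \<mu> < \<infinity>"
proof -
  note N = \<open>is_norm N\<close> and r = \<open>0 < r\<close> and b = \<open>0 < b\<close> \<open>b < 1 / 2\<close>
  note f = \<open>f \<in> borel_measurable borel\<close> \<open>\<And>x. 0 \<le> f x\<close> and opt = \<open>optimal_quantizers N r P \<alpha>\<close>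
  note X = \<open>X \<in> borel_measurable M\<close> and PX = \<open>P = distr M borel X\<close>
    and Pf = \<open>P = density lborel (\<lambda>x. ennreal (f x))\<close>
  have s: "0 < s" using r \<open>r < s\<close> by simp
  interpret M: prob_space M by fact
  have P: "prob_space P" unfolding PX using X by (rule M.prob_space_distr)
  interpret P: prob_space P by (rule P)
  have sP [simp, measurable_cong]: "sets P = sets borel" by (simp add: PX)
  note [measurable] = f(1)
  have \<alpha>: "finite (\<alpha> n)" "\<alpha> n \<noteq> {}" if "1 \<le> n" for n
    using opt that by (auto simp: optimal_quantizers_def quantizers_def)
  obtain \<eta> where \<eta>: "0 < \<eta>" "Lp_norm_pow N M (r + \<eta>) X < \<infinity>"
    using \<open>\<exists>\<eta>>0. Lp_norm_pow N M (r + \<eta>) X < \<infinity>\<close> by blast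
  have mom: "(\<integral>\<^sup>+ x. ennreal (N x powr (r + \<eta>)) \<partial>P) < \<infinity>"
    using \<eta>(2) X is_norm_borel_measurable[OF N] unfolding PX Lp_norm_pow_def
    by (subst nn_integral_distr) auto
  obtain C1 where C1: "0 < C1"
    "\<forall>\<^sub>F n in sequentially. \<forall>x. ndist N x (\<alpha> n) powr r * measure P (nball N x (b * ndist N x (\<alpha> n)))
        \<le> C1 * n powr (- (1 + r / CARD('d)))"
    by (rule optimal_quantizers_pointwise_rate[OF N r \<eta>(1) b f P Pf mom opt]) (blast intro: that)
  obtain n0 where n0: "\<And>n x. n0 \<le> n \<Longrightarrow>
        ndist N x (\<alpha> n) powr r * measure P (nball N x (b * ndist N x (\<alpha> n)))
        \<le> C1 * n powr (- (1 + r / CARD('d)))" "1 \<le> n0"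
  proof -
    obtain k where "\<And>n x. k \<le> n \<Longrightarrow>
        ndist N x (\<alpha> n) powr r * measure P (nball N x (b * ndist N x (\<alpha> n)))
        \<le> C1 * n powr (- (1 + r / CARD('d)))"
      using C1(2) unfolding eventually_sequentially by blast
    then show ?thesis by (intro that[of "max 1 k"]) auto
  qed
  define p where "p = s / (CARD('d) + r)"
  have p: "0 < p" using r s by (simp add: p_def add_nonneg_pos)
  define E where "E = (C1 / (measure lborel (nball N 0 1) * b ^ CARD('d))) powr p"
  have E: "0 < E" using C1(1) b measure_nball_pos[OF N] by (simp add: E_def)
  define C where "C = E * 2 powr p"
  have C: "0 < C" using E by (simp add: C_def)
  let ?\<psi> = "\<lambda>x. ennpowr (maximal_fun N P \<alpha> b x) p"
  let ?D = "\<lambda>n x. n powr (s / CARD('d)) * ndist N x (\<alpha> n) powr s"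
  let ?q = "\<lambda>n x. emeasure lborel (nball N x (b * ndist N x (\<alpha> n)))
                / emeasure P (nball N x (b * ndist N x (\<alpha> n)))"
  have rate: "ennreal (?D n x) \<le> ennreal E * ennpowr (?q n x) p" if "n0 \<le> n" for n x
    unfolding E_def p_def
    using that n0 \<alpha>[of n]
    by (intro rate_le_ball_quotient[OF N r s b(1) C1(1)]) (auto simp: P.finite_measure_axioms)
  have dominated: "ennreal (?D n x) \<le> ennreal E * ?\<psi> x" if "n0 \<le> n" for n x
  proof -
    note rate[OF that, of x]
    also have "ennreal E * ennpowr (?q n x) p \<le> ennreal E * ?\<psi> x"
      using p that n0(2) by (intro mult_left_mono ennpowr_mono ball_quotient_le_maximal_fun) auto
    finally show ?thesis .
  qed
  let ?L = "\<lambda>x. ((\<lambda>\<rho>. measure P (nball N x \<rho>) / measure lborel (nball N x \<rho>)) \<longlongrightarrow> f x) (at_right 0)"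
  have "finite_measure (density lborel (\<lambda>x. ennreal (f x)))"
    using P.finite_measure_axioms unfolding Pf .
  from lebesgue_differentiation_nball[OF N f this]
  have L: "AE x in lborel. ?L x" unfolding Pf .
  \<comment> \<open>the points of the quantizers, where the balls degenerate, form a countable and hence null set\<close>
  have "countable (\<Union>n\<in>{1..}. \<alpha> n)"
    using \<alpha>(1) by (intro countable_UN) (auto intro: countable_finite)
  then have "AE x in lborel. x \<notin> (\<Union>n\<in>{1..}. \<alpha> n)"
    by (intro AE_not_in countable_imp_null_set_lborel)
  with L have good: "AE x in P. 0 < f x \<and> ?L x \<and> x \<notin> (\<Union>n\<in>{1..}. \<alpha> n)"
    unfolding Pf by (subst AE_density) (auto simp: ennreal_less_zero_iff elim: eventually_elim2)
  show ?thesis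
  proof (intro exI[of _ C] conjI allI impI)
    show "0 < C" by (rule C)
    fix \<theta> :: real assume \<theta>: "0 < \<theta>"
    let ?Q = "dilated_measure \<theta> \<mu> P"
    assume ac: "absolutely_continuous P ?Q"
      and int: "in_L1 ?Q (\<lambda>x. ennpowr (maximal_fun N P \<alpha> b x) (s / (real CARD('d) + r)))"
    have sQ [simp, measurable_cong]: "sets ?Q = sets borel" by (simp add: dilated_measure_def)
    have \<psi>: "?\<psi> \<in> borel_measurable ?Q" "(\<integral>\<^sup>+ x. ?\<psi> x \<partial>?Q) < \<infinity>"
      using int by (auto simp: in_L1_def p_def)
    have "AE x in ?Q. 0 < f x \<and> ?L x \<and> x \<notin> (\<Union>n\<in>{1..}. \<alpha> n)"
      by (rule absolutely_continuous_AE[OF _ ac good]) simp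
    moreover have "AE x in ?Q. ?\<psi> x \<noteq> \<infinity>"
      using \<psi> by (intro nn_integral_PInf_AE) auto
    ultimately have at_generic_point: "AE x in ?Q.
        (\<forall>\<^sub>F n in sequentially. ?D n x \<le> C * f x powr (- p)) \<and>
        ennreal (f x powr (- p)) \<le> ennreal (2 powr p) * ?\<psi> x"
    proof eventually_elim
      fix x assume x: "0 < f x \<and> ?L x \<and> x \<notin> (\<Union>n\<in>{1..}. \<alpha> n)" and fin: "?\<psi> x \<noteq> \<infinity>"
      have fin': "maximal_fun N P \<alpha> b x < \<infinity>"
        using fin by (auto simp: ennpowr_def less_top[symmetric])
      have ev: "\<forall>\<^sub>F n in sequentially. ennreal (?D n x) \<le> ennreal E * ennpowr (?q n x) p"
        using eventually_ge_at_top[of n0] by eventually_elim (rule rate)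
      have \<alpha>x: "finite (\<alpha> n) \<and> \<alpha> n \<noteq> {} \<and> x \<notin> \<alpha> n" if "1 \<le> n" for n
        using \<alpha>[OF that] x that by auto
      have fx: "0 < f x" and Lx: "?L x" using x by auto
      note * = local_limsup_and_maximal_fun_bound[OF N P.finite_measure_axioms s p b(1) fx \<alpha>x fin' Lx ev less_imp_le[OF E]]
      show "(\<forall>\<^sub>F n in sequentially. ?D n x \<le> C * f x powr (- p)) \<and>
          ennreal (f x powr (- p)) \<le> ennreal (2 powr p) * ?\<psi> x"
        using * unfolding C_def by blast
    qed
    let ?J = "\<integral>\<^sup>+ x. ennreal (f x powr (- p)) \<partial>?Q"
    have J: "ennreal (\<theta> powr s * C) * ?J
        = ennreal (\<theta> powr (s + real CARD('d)) * C) * dilation_integral f r s \<theta> \<mu>"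
    proof -
      have h: "(\<lambda>x. ennreal (f x powr (- p))) \<in> borel_measurable borel" by measurable
      have "?J = ennreal (\<theta> ^ CARD('d)) * dilation_integral f r s \<theta> \<mu>"
        unfolding dilation_integral_def nn_integral_dilated_measure[OF Pf f(1) \<theta> h]
        by (simp add: p_def ennreal_mult'[symmetric] dilated_fun_def f(2))
      moreover have "\<theta> powr s * C * \<theta> ^ CARD('d) = \<theta> powr (s + real CARD('d)) * C"
        using \<theta> by (simp add: powr_add powr_realpow)
      then have "ennreal (\<theta> powr s * C) * ennreal (\<theta> ^ CARD('d)) = ennreal (\<theta> powr (s + real CARD('d)) * C)"
        using \<theta> C by (simp add: ennreal_mult[symmetric])
      ultimately show ?thesis
        by (simp only: mult.assoc[symmetric])
    qed
    have "?J \<le> (\<integral>\<^sup>+ x. ennreal (2 powr p) * ?\<psi> x \<partial>?Q)"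
      using at_generic_point by (intro nn_integral_mono_AE) auto
    also have "\<dots> = ennreal (2 powr p) * (\<integral>\<^sup>+ x. ?\<psi> x \<partial>?Q)"
      by (rule nn_integral_cmult[OF \<psi>(1)])
    also have "\<dots> < \<infinity>" using \<psi>(2) by (simp add: ennreal_mult_less_top)
    finally have "ennreal (\<theta> powr s * C) * ?J < \<infinity>" by (simp add: ennreal_mult_less_top)
    then show "ennreal (\<theta> powr (s + real CARD('d)) * C) * dilation_integral f r s \<theta> \<mu> < \<infinity>"
      unfolding J .
    fix Xhat
    assume Xhat: "\<forall>n\<ge>1. voronoi_quantization N M X (dilated_set \<theta> \<mu> (\<alpha> n)) (Xhat n)"
    \<comment> \<open>set to \<open>0\<close> below \<open>n0\<close>, where the pointwise rate need not hold, so that all terms are dominated\<close>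
    let ?u = "\<lambda>n x. if n < n0 then 0 else ennreal (\<theta> powr s * ?D n x)"
    have ndist_meas: "(\<lambda>x. ndist N x (\<alpha> n)) \<in> borel_measurable borel" if "n0 \<le> n" for n
      using that n0(2) by (intro ndist_borel_measurable[OF N \<alpha>(1)]) simp
    have u: "ennreal (real n powr (s / real CARD('d))) * Lp_norm_pow N M s (\<lambda>\<omega>. X \<omega> - Xhat n \<omega>)
        = integral\<^sup>N ?Q (?u n)" if n: "n0 \<le> n" for n
    proof -
      have n1: "1 \<le> n" using n n0(2) by simp
      have [measurable]: "(\<lambda>x. ndist N x (\<alpha> n)) \<in> borel_measurable borel"
        by (rule ndist_meas[OF n])
      have "integral\<^sup>N ?Q (?u n) = (\<integral>\<^sup>+ x. ennreal (\<theta> powr s * n powr (s / CARD('d)))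
          * ennreal (ndist N x (\<alpha> n) powr s) \<partial>?Q)"
        using n by (intro nn_integral_cong) (simp add: ennreal_mult[symmetric] mult.assoc)
      also have "\<dots> = ennreal (\<theta> powr s * n powr (s / CARD('d)))
          * (\<integral>\<^sup>+ x. ennreal (ndist N x (\<alpha> n) powr s) \<partial>?Q)"
        by (rule nn_integral_cmult) measurable
      finally show ?thesis
        unfolding Lp_norm_pow_voronoi_dilated[OF N X PX \<alpha>[OF n1] \<theta> Xhat[rule_format, OF n1]]
        by (simp add: ennreal_mult mult_ac)
    qed
    have "limsup (\<lambda>n. ennreal (real n powr (s / real CARD('d))) * Lp_norm_pow N M s (\<lambda>\<omega>. X \<omega> - Xhat n \<omega>))
        \<le> limsup (\<lambda>n. integral\<^sup>N ?Q (?u n))"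
      using eventually_ge_at_top[of n0] by (intro Limsup_mono, eventually_elim) (simp only: u)
    also have "\<dots> \<le> (\<integral>\<^sup>+ x. limsup (\<lambda>n. ?u n x) \<partial>?Q)"
    proof (rule nn_integral_limsup[where w = "\<lambda>x. ennreal (\<theta> powr s * E) * ?\<psi> x"])
      show "?u n \<in> borel_measurable ?Q" for n
      proof (cases "n < n0")
        case False
        then have [measurable]: "(\<lambda>x. ndist N x (\<alpha> n)) \<in> borel_measurable borel"
          using ndist_meas[of n] by simp
        have "(\<lambda>x. ennreal (\<theta> powr s * ?D n x)) \<in> borel_measurable ?Q" by measurable
        then show ?thesis using False by simp
      qed simp
      show "(\<lambda>x. ennreal (\<theta> powr s * E) * ?\<psi> x) \<in> borel_measurable ?Q"
        using \<psi>(1) by measurable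
      show "AE x in ?Q. ?u n x \<le> ennreal (\<theta> powr s * E) * ?\<psi> x" for n
      proof (cases "n < n0")
        case False
        have "ennreal (\<theta> powr s * ?D n x) \<le> ennreal (\<theta> powr s * E) * ?\<psi> x" for x
          using mult_left_mono[OF dominated[of n x], of "ennreal (\<theta> powr s)"] False E
          by (simp add: ennreal_mult mult.assoc)
        then show ?thesis using False by simp
      qed simp
      have "(\<integral>\<^sup>+ x. ennreal (\<theta> powr s * E) * ?\<psi> x \<partial>?Q) = ennreal (\<theta> powr s * E) * (\<integral>\<^sup>+ x. ?\<psi> x \<partial>?Q)"
        by (rule nn_integral_cmult[OF \<psi>(1)])
      also have "\<dots> < \<infinity>" using \<psi>(2) by (simp add: ennreal_mult_less_top)
      finally show "(\<integral>\<^sup>+ x. ennreal (\<theta> powr s * E) * ?\<psi> x \<partial>?Q) < \<infinity>" .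
    qed
    also have "\<dots> \<le> (\<integral>\<^sup>+ x. ennreal (\<theta> powr s * C) * ennreal (f x powr (- p)) \<partial>?Q)"
    proof (rule nn_integral_mono_AE)
      show "AE x in ?Q. limsup (\<lambda>n. ?u n x) \<le> ennreal (\<theta> powr s * C) * ennreal (f x powr (- p))"
        using at_generic_point
      proof eventually_elim
        fix x
        assume "(\<forall>\<^sub>F n in sequentially. ?D n x \<le> C * f x powr (- p)) \<and>
          ennreal (f x powr (- p)) \<le> ennreal (2 powr p) * ?\<psi> x"
        then have "\<forall>\<^sub>F n in sequentially. ?D n x \<le> C * f x powr (- p)" by blast
        then have "\<forall>\<^sub>F n in sequentially. ?u n x \<le> ennreal (\<theta> powr s * C) * ennreal (f x powr (- p))"
        proof eventually_elim
          fix n assume "?D n x \<le> C * f x powr (- p)"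
          then have "\<theta> powr s * ?D n x \<le> \<theta> powr s * (C * f x powr (- p))"
            by (rule mult_left_mono) simp
          then show "?u n x \<le> ennreal (\<theta> powr s * C) * ennreal (f x powr (- p))"
            using C by (simp add: ennreal_mult[symmetric] mult.assoc ennreal_leI)
        qed
        then show "limsup (\<lambda>n. ?u n x) \<le> ennreal (\<theta> powr s * C) * ennreal (f x powr (- p))"
          by (rule Limsup_bounded)
      qed
    qed
    also have "\<dots> = ennreal (\<theta> powr s * C) * ?J"
      by (rule nn_integral_cmult) measurable
    also note J
    finally show "limsup (\<lambda>n. ennreal (real n powr (s / real CARD('d))) *
        Lp_norm_pow N M s (\<lambda>\<omega>. X \<omega> - Xhat n \<omega>))
      \<le> ennreal (\<theta> powr (s + real CARD('d)) * C) * dilation_integral f r s \<theta> \<mu>" .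
  qed
qed

end
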